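(* For every integer $n \geq 1$, $$ \sup \left\{ \frac{|\partial \Omega_1|}{|\Omega_1|} \, \frac{|\Omega_2|}{|\partial \Omega_2|} \; : \; \Omega_2 \subset \Omega_1, \ \Omega_1 \text{ and } \Omega_2 \text{ both convex domains in } \mathbb{R}^{n} \right\} = n. $$
   Context: A convex domain in $\mathbb{R}^n$ is a nonempty bounded open convex set. $|\Omega|$ denotes $n$-dimensional Lebesgue measure and $|\partial\Omega|$ denotes the $(n-1)$-dimensional Hausdorff (surface) measure of the boundary (for $n=1$, counting measure, so $|\partial\Omega|=2$). *)

theory Defs
  imports "HOL-Analysis.Analysis"
begin

text \<open>
  The \<open>d\<close>-dimensional Hausdorff (outer) measure, normalised by the volume of the
  \<open>d\<close>-dimensional ball of diameter \<open>diameter A\<close>, so that in \<open>d\<close>-dimensional Euclidean space it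
  is Lebesgue measure and for \<open>d = 0\<close> it is counting measure. The empty set is treated separately
  because \<open>0 ^ 0 = 1\<close>: for \<open>d = 0\<close> a point has gauge 1, but the empty set must have gauge 0.
\<close>

definition hausdorff_gauge :: "nat \<Rightarrow> 'a::metric_space set \<Rightarrow> real" where
  "hausdorff_gauge d A =
     (if A = {} then 0 else unit_ball_vol (real d) * (diameter A / 2) ^ d)"

text \<open>Boundedness is required because \<open>diameter\<close> is unspecified on unbounded sets.\<close>

definition hausdorff_covers :: "real \<Rightarrow> 'a::metric_space set \<Rightarrow> (nat \<Rightarrow> 'a set) set" where
  "hausdorff_covers \<delta> S =
     {U. S \<subseteq> (\<Union>i. U i) \<and> (\<forall>i. bounded (U i) \<and> diameter (U i) \<le> \<delta>)}"

definition hausdorff_premeasure :: "nat \<Rightarrow> real \<Rightarrow> 'a::metric_space set \<Rightarrow> ennreal" where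
  "hausdorff_premeasure d \<delta> S =
     (INF U\<in>hausdorff_covers \<delta> S. \<Sum>i. ennreal (hausdorff_gauge d (U i)))"

definition hausdorff_measure :: "nat \<Rightarrow> 'a::metric_space set \<Rightarrow> ennreal" where
  "hausdorff_measure d S = (SUP \<delta>\<in>{0<..}. hausdorff_premeasure d \<delta> S)"

definition convex_domain :: "'a::euclidean_space set \<Rightarrow> bool" where
  "convex_domain \<Omega> \<longleftrightarrow> \<Omega> \<noteq> {} \<and> bounded \<Omega> \<and> open \<Omega> \<and> convex \<Omega>"

definition surface_measure :: "'a::euclidean_space set \<Rightarrow> ennreal" where
  "surface_measure \<Omega> = hausdorff_measure (DIM('a) - 1) (frontier \<Omega>)"

end

theory Submission
  imports Defs
begin

text \<open>
  For a polytope \<open>P\<close> with unit outer normals, glue prisms of height \<open>t\<close> to the facets. Outward prisms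
  are disjoint and leave \<open>P\<close>, so \<open>t |\<partial>P| + |P|\<close> is at most the volume of any set that contains \<open>P\<close> and
  the prisms (\<open>surface_le_outer_layer\<close>). Inward prisms cover the points of depth at most \<open>t\<close>, so the
  volume of that layer is at most \<open>t |\<partial>P|\<close> (\<open>depth_layer_le_surface\<close>). If \<open>P\<close> contains a ball of
  radius \<open>r\<close>, the outward prisms of height \<open>t r\<close> lie in a copy of \<open>P\<close> scaled by \<open>1 + t\<close>; for \<open>t \<rightarrow> 0\<close>
  this gives \<open>r |\<partial>P| \<le> n |P|\<close>. If \<open>r\<close> is the largest such radius, every point has depth at most \<open>r\<close>,
  and \<open>|P| \<le> r |\<partial>P|\<close>. Surface measure is monotone under inclusion of convex sets
  (\<open>hausdorff_measure_frontier_mono\<close>), so approximation by polytopes (\<open>polytope_between\<close>) extends both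
  inequalities to convex domains. A largest ball in \<open>\<Omega>\<^sub>2\<close> also lies in \<open>\<Omega>\<^sub>1\<close>, and multiplying
  \<open>r |\<partial>\<Omega>\<^sub>1| \<le> n |\<Omega>\<^sub>1|\<close> by \<open>|\<Omega>\<^sub>2| \<le> r |\<partial>\<Omega>\<^sub>2|\<close> bounds the ratio by \<open>n\<close> (\<open>ratio_le_dimension\<close>).

  The first inequality is an equality for polytopes circumscribed about a ball, the second is
  nearly an equality for a wide flat box. Flat double pyramids, truncated so as to
  be circumscribed, contain boxes of nearly the same inradius that are arbitrarily wide, and so the bound is approached (\<open>nearly_extremal_domains\<close>).

  On flat sets Hausdorff measure and area differ by a constant factor, the Hausdorff measure of the
  unit cube (\<open>hausdorff_measure_flat_compact\<close>, \<open>hausdorff_measure_flat_open\<close>). The factor is positive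
  and finite and cancels in the ratio, so that the isodiametric inequality, which would give its value, is avoided.
\<close>

section \<open>Hausdorff outer measure\<close>

lemma hausdorff_gauge_mono:
  assumes "A \<subseteq> B" "bounded B"
  shows "hausdorff_gauge d A \<le> hausdorff_gauge d B"
  using assms diameter_subset[OF assms] bounded_subset[OF assms(2,1)]
  by (auto simp: hausdorff_gauge_def diameter_ge_0 intro!: mult_left_mono power_mono mult_nonneg_nonneg)

lemma hausdorff_gauge_empty [simp]: "hausdorff_gauge d {} = 0"
  by (simp add: hausdorff_gauge_def)

lemma hausdorff_premeasure_le:
  assumes "S \<subseteq> (\<Union>i. U i)" "\<And>i. bounded (U i)" "\<And>i. diameter (U i) \<le> \<delta>"
  shows "hausdorff_premeasure d \<delta> S \<le> (\<Sum>i. ennreal (hausdorff_gauge d (U i)))"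
  unfolding hausdorff_premeasure_def hausdorff_covers_def
  using assms by (intro INF_lower) auto

lemma hausdorff_premeasure_greatest:
  assumes "\<And>U. S \<subseteq> (\<Union>i. U i) \<Longrightarrow> (\<And>i. bounded (U i)) \<Longrightarrow> (\<And>i. diameter (U i) \<le> \<delta>) \<Longrightarrow>
             c \<le> (\<Sum>i. ennreal (hausdorff_gauge d (U i)))"
  shows "c \<le> hausdorff_premeasure d \<delta> S"
  unfolding hausdorff_premeasure_def hausdorff_covers_def
  using assms by (intro INF_greatest) auto

lemma hausdorff_premeasure_antimono:
  "\<delta> \<le> \<epsilon> \<Longrightarrow> hausdorff_premeasure d \<epsilon> S \<le> hausdorff_premeasure d \<delta> S"
  by (intro hausdorff_premeasure_greatest hausdorff_premeasure_le) (auto intro: order_trans)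

lemma hausdorff_premeasure_le_gauge:
  assumes "bounded S" "diameter S \<le> \<delta>"
  shows "hausdorff_premeasure d \<delta> S \<le> ennreal (hausdorff_gauge d S)"
proof -
  define U where "U i = (if i = (0::nat) then S else {})" for i
  have "0 \<le> \<delta>"
    using assms diameter_ge_0 by force
  then have "hausdorff_premeasure d \<delta> S \<le> (\<Sum>i. ennreal (hausdorff_gauge d (U i)))"
    using assms by (intro hausdorff_premeasure_le) (auto simp: U_def)
  also have "\<dots> = (\<Sum>i\<in>{0}. ennreal (hausdorff_gauge d (U i)))"
    by (intro suminf_finite) (auto simp: U_def)
  finally show ?thesis
    by (simp add: U_def)
qed

lemma hausdorff_premeasure_Un:
  "hausdorff_premeasure d \<delta> (S \<union> T) \<le> hausdorff_premeasure d \<delta> S + hausdorff_premeasure d \<delta> T"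
proof -
  have *: "hausdorff_premeasure d \<delta> (S \<union> T)
        \<le> (\<Sum>i. ennreal (hausdorff_gauge d (U i))) + (\<Sum>i. ennreal (hausdorff_gauge d (V i)))"
    if U: "S \<subseteq> (\<Union>i. U i)" "\<And>i. bounded (U i)" "\<And>i. diameter (U i) \<le> \<delta>"
      and V: "T \<subseteq> (\<Union>i. V i)" "\<And>i. bounded (V i)" "\<And>i. diameter (V i) \<le> \<delta>" for U V
  proof -
    define W where "W i = (if even i then U (i div 2) else V (i div 2))" for i :: nat
    have W: "W (2*i) = U i" "W (Suc (2*i)) = V i" for i
      by (auto simp: W_def)
    have "S \<union> T \<subseteq> (\<Union>i. W i)"
      using U(1) V(1) W by (metis (no_types, opaque_lifting) SUP_least Sup_upper Un_least order_trans rangeI)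
    then have "hausdorff_premeasure d \<delta> (S \<union> T) \<le> (\<Sum>i. ennreal (hausdorff_gauge d (W i)))"
      using U V by (intro hausdorff_premeasure_le) (auto simp: W_def)
    also have "\<dots> \<le> (\<Sum>i. ennreal (hausdorff_gauge d (U i))) + (\<Sum>i. ennreal (hausdorff_gauge d (V i)))"
    proof (rule suminf_le_const)
      fix n
      have eq: "(\<Sum>i<2*m. ennreal (hausdorff_gauge d (W i)))
          = (\<Sum>i<m. ennreal (hausdorff_gauge d (U i))) + (\<Sum>i<m. ennreal (hausdorff_gauge d (V i)))" for m
        by (induction m) (simp_all add: W W[unfolded mult.commute[of 2]] ac_simps)
      have "(\<Sum>i<n. ennreal (hausdorff_gauge d (W i))) \<le> (\<Sum>i<2*n. ennreal (hausdorff_gauge d (W i)))"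
        by (intro sum_mono2) auto
      also have "\<dots> \<le> (\<Sum>i. ennreal (hausdorff_gauge d (U i))) + (\<Sum>i. ennreal (hausdorff_gauge d (V i)))"
        unfolding eq by (intro add_mono sum_le_suminf) auto
      finally show "(\<Sum>i<n. ennreal (hausdorff_gauge d (W i)))
        \<le> (\<Sum>i. ennreal (hausdorff_gauge d (U i))) + (\<Sum>i. ennreal (hausdorff_gauge d (V i)))" .
    qed auto
    finally show ?thesis .
  qed
  show ?thesis
  proof (rule ennreal_le_epsilon)
    fix e :: real
    assume fin: "hausdorff_premeasure d \<delta> S + hausdorff_premeasure d \<delta> T < top" and e: "0 < e"
    have near: "\<exists>U. X \<subseteq> (\<Union>i. U i) \<and> (\<forall>i. bounded (U i)) \<and> (\<forall>i. diameter (U i) \<le> \<delta>) \<and>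
         (\<Sum>i. ennreal (hausdorff_gauge d (U i))) \<le> hausdorff_premeasure d \<delta> X + ennreal (e/2)"
      if "hausdorff_premeasure d \<delta> X < top" for X :: "'a set"
    proof -
      have "hausdorff_premeasure d \<delta> X < hausdorff_premeasure d \<delta> X + ennreal (e/2)"
        using that e by (simp add: ennreal_less_zero_iff)
      then show ?thesis
        unfolding hausdorff_premeasure_def[of d \<delta> X, THEN arg_cong2[where f="(<)", OF _ refl]] INF_less_iff
        unfolding hausdorff_covers_def by (blast intro: less_imp_le)
    qed
    obtain U V where U: "S \<subseteq> (\<Union>i. U i)" "\<And>i. bounded (U i)" "\<And>i. diameter (U i) \<le> \<delta>"
        "(\<Sum>i. ennreal (hausdorff_gauge d (U i))) \<le> hausdorff_premeasure d \<delta> S + ennreal (e/2)"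
      and V: "T \<subseteq> (\<Union>i. V i)" "\<And>i. bounded (V i)" "\<And>i. diameter (V i) \<le> \<delta>"
        "(\<Sum>i. ennreal (hausdorff_gauge d (V i))) \<le> hausdorff_premeasure d \<delta> T + ennreal (e/2)"
      using near[of S] near[of T] fin by (auto simp: ennreal_add_less_top)
    have "hausdorff_premeasure d \<delta> (S \<union> T)
        \<le> (hausdorff_premeasure d \<delta> S + ennreal (e/2)) + (hausdorff_premeasure d \<delta> T + ennreal (e/2))"
      by (rule order_trans[OF *[OF U(1-3) V(1-3)] add_mono[OF U(4) V(4)]])
    also have "\<dots> = hausdorff_premeasure d \<delta> S + hausdorff_premeasure d \<delta> T + (ennreal (e/2) + ennreal (e/2))"
      by (simp only: ac_simps)
    also have "ennreal (e/2) + ennreal (e/2) = ennreal e"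
      using e by (simp flip: ennreal_plus)
    finally show "hausdorff_premeasure d \<delta> (S \<union> T)
        \<le> hausdorff_premeasure d \<delta> S + hausdorff_premeasure d \<delta> T + ennreal e" .
  qed
qed

lemma hausdorff_premeasure_empty [simp]:
  "0 \<le> \<delta> \<Longrightarrow> hausdorff_premeasure d \<delta> {} = 0"
  using hausdorff_premeasure_le_gauge[of "{}" \<delta> d] by simp

lemma hausdorff_premeasure_UN:
  assumes "finite I" "0 \<le> \<delta>"
  shows "hausdorff_premeasure d \<delta> (\<Union>i\<in>I. S i) \<le> (\<Sum>i\<in>I. hausdorff_premeasure d \<delta> (S i))"
  using assms(1)
proof induction
  case (insert i I)
  then show ?case
    using hausdorff_premeasure_Un[of d \<delta> "S i" "\<Union>i\<in>I. S i"]
    by (auto intro: order_trans add_left_mono)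
qed (simp add: assms)

lemma hausdorff_premeasure_le_measure:
  "0 < \<delta> \<Longrightarrow> hausdorff_premeasure d \<delta> S \<le> hausdorff_measure d S"
  unfolding hausdorff_measure_def by (intro SUP_upper) auto

lemma hausdorff_measure_least:
  "(\<And>\<delta>. 0 < \<delta> \<Longrightarrow> hausdorff_premeasure d \<delta> S \<le> c) \<Longrightarrow> hausdorff_measure d S \<le> c"
  unfolding hausdorff_measure_def by (intro SUP_least) auto

lemma hausdorff_measure_mono:
  assumes "S \<subseteq> T"
  shows "hausdorff_measure d S \<le> hausdorff_measure d T"
proof (rule hausdorff_measure_least)
  fix \<delta> :: real assume "0 < \<delta>"
  have "hausdorff_premeasure d \<delta> S \<le> hausdorff_premeasure d \<delta> T"
    using assms by (intro hausdorff_premeasure_greatest hausdorff_premeasure_le) auto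
  also have "\<dots> \<le> hausdorff_measure d T"
    using \<open>0 < \<delta>\<close> by (rule hausdorff_premeasure_le_measure)
  finally show "hausdorff_premeasure d \<delta> S \<le> hausdorff_measure d T" .
qed

lemma hausdorff_measure_UN:
  assumes "finite I"
  shows "hausdorff_measure d (\<Union>i\<in>I. S i) \<le> (\<Sum>i\<in>I. hausdorff_measure d (S i))"
proof (rule hausdorff_measure_least)
  fix \<delta> :: real assume "0 < \<delta>"
  then have "hausdorff_premeasure d \<delta> (\<Union>i\<in>I. S i) \<le> (\<Sum>i\<in>I. hausdorff_premeasure d \<delta> (S i))"
    using assms by (intro hausdorff_premeasure_UN) auto
  also have "\<dots> \<le> (\<Sum>i\<in>I. hausdorff_measure d (S i))"
    using \<open>0 < \<delta>\<close> by (intro sum_mono hausdorff_premeasure_le_measure)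
  finally show "hausdorff_premeasure d \<delta> (\<Union>i\<in>I. S i) \<le> (\<Sum>i\<in>I. hausdorff_measure d (S i))" .
qed

lemma hausdorff_measure_Un:
  "hausdorff_measure d (S \<union> T) \<le> hausdorff_measure d S + hausdorff_measure d T"
  using hausdorff_measure_UN[of "{True, False}" d "\<lambda>b. if b then S else T"]
  by (simp add: UN_bool_eq Un_commute)

text \<open>A set of diameter below the gap \<open>\<eta>\<close> meets at most one of the two sets, so every fine cover
  of the union splits into a cover of \<open>S\<close> and a cover of \<open>T\<close>.\<close>

lemma hausdorff_measure_Un_separated:
  assumes "0 < \<eta>" and gap: "\<And>x y. x \<in> S \<Longrightarrow> y \<in> T \<Longrightarrow> \<eta> \<le> dist x y"
  shows "hausdorff_measure d S + hausdorff_measure d T \<le> hausdorff_measure d (S \<union> T)"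
proof -
  have split: "hausdorff_premeasure d \<delta> S + hausdorff_premeasure d \<delta> T \<le> hausdorff_premeasure d \<delta> (S \<union> T)"
    if "\<delta> < \<eta>" for \<delta>
  proof (rule hausdorff_premeasure_greatest)
    fix U :: "nat \<Rightarrow> 'a set"
    assume U: "S \<union> T \<subseteq> (\<Union>i. U i)" "\<And>i. bounded (U i)" "\<And>i. diameter (U i) \<le> \<delta>"
    have sub: "diameter (U i \<inter> X) \<le> \<delta>" "bounded (U i \<inter> X)"
      "hausdorff_gauge d (U i \<inter> X) \<le> hausdorff_gauge d (U i)" for i X
      using diameter_subset[of "U i \<inter> X" "U i"] U(2,3)[of i] hausdorff_gauge_mono[of "U i \<inter> X" "U i"]
      by (auto intro: bounded_Int)
    have "hausdorff_premeasure d \<delta> S + hausdorff_premeasure d \<delta> T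
      \<le> (\<Sum>i. ennreal (hausdorff_gauge d (U i \<inter> S))) + (\<Sum>i. ennreal (hausdorff_gauge d (U i \<inter> T)))"
      using U(1) sub by (intro add_mono hausdorff_premeasure_le) auto
    also have "\<dots> = (\<Sum>i. ennreal (hausdorff_gauge d (U i \<inter> S)) + ennreal (hausdorff_gauge d (U i \<inter> T)))"
      by (intro suminf_add) auto
    also have "\<dots> \<le> (\<Sum>i. ennreal (hausdorff_gauge d (U i)))"
    proof (intro suminf_le)
      fix i
      have "U i \<inter> S = {} \<or> U i \<inter> T = {}"
      proof (rule ccontr)
        assume "\<not> ?thesis"
        then obtain x y where "x \<in> U i" "x \<in> S" "y \<in> U i" "y \<in> T"
          by blast
        then show False
          using diameter_bounded_bound[OF U(2)[of i], of x y] U(3)[of i] gap[of x y] \<open>\<delta> < \<eta>\<close> by simp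
      qed
      then show "ennreal (hausdorff_gauge d (U i \<inter> S)) + ennreal (hausdorff_gauge d (U i \<inter> T))
          \<le> ennreal (hausdorff_gauge d (U i))"
        using sub(3)[of i S] sub(3)[of i T] by (auto intro: ennreal_leI)
    qed auto
    finally show "hausdorff_premeasure d \<delta> S + hausdorff_premeasure d \<delta> T
      \<le> (\<Sum>i. ennreal (hausdorff_gauge d (U i)))" .
  qed
  have "hausdorff_measure d S + hausdorff_measure d T
      = (SUP \<delta>\<in>{0<..}. hausdorff_premeasure d \<delta> S + hausdorff_premeasure d \<delta> T)"
    unfolding hausdorff_measure_def
  proof (intro SUP_add_directed_ennreal[symmetric])
    fix \<delta> \<epsilon> :: real
    assume "\<delta> \<in> {0<..}" "\<epsilon> \<in> {0<..}"
    then show "\<exists>k\<in>{0<..}. hausdorff_premeasure d \<delta> S + hausdorff_premeasure d \<epsilon> T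
        \<le> hausdorff_premeasure d k S + hausdorff_premeasure d k T"
      by (intro bexI[of _ "min \<delta> \<epsilon>"] add_mono hausdorff_premeasure_antimono) auto
  qed
  also have "\<dots> \<le> hausdorff_measure d (S \<union> T)"
  proof (rule SUP_least)
    fix \<delta> :: real
    assume \<delta>: "\<delta> \<in> {0<..}"
    define \<epsilon> where "\<epsilon> = min \<delta> (\<eta>/2)"
    have \<epsilon>: "0 < \<epsilon>" "\<epsilon> < \<eta>" "\<epsilon> \<le> \<delta>"
      using \<delta> \<open>0 < \<eta>\<close> by (auto simp: \<epsilon>_def)
    have "hausdorff_premeasure d \<delta> S + hausdorff_premeasure d \<delta> T
      \<le> hausdorff_premeasure d \<epsilon> S + hausdorff_premeasure d \<epsilon> T"
      using \<epsilon> by (intro add_mono hausdorff_premeasure_antimono) auto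
    also have "\<dots> \<le> hausdorff_premeasure d \<epsilon> (S \<union> T)"
      using \<epsilon> by (intro split) auto
    also have "\<dots> \<le> hausdorff_measure d (S \<union> T)"
      using \<epsilon> by (intro hausdorff_premeasure_le_measure) auto
    finally show "hausdorff_premeasure d \<delta> S + hausdorff_premeasure d \<delta> T \<le> hausdorff_measure d (S \<union> T)" .
  qed
  finally show ?thesis .
qed

lemma hausdorff_measure_UN_separated:
  assumes "finite I" "0 < \<eta>"
    and "\<And>i j x y. i \<in> I \<Longrightarrow> j \<in> I \<Longrightarrow> i \<noteq> j \<Longrightarrow> x \<in> S i \<Longrightarrow> y \<in> S j \<Longrightarrow> \<eta> \<le> dist x y"
  shows "(\<Sum>i\<in>I. hausdorff_measure d (S i)) \<le> hausdorff_measure d (\<Union>i\<in>I. S i)"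
  using assms(1,3)
proof induction
  case (insert i I)
  have "(\<Sum>i\<in>insert i I. hausdorff_measure d (S i))
      \<le> hausdorff_measure d (S i) + hausdorff_measure d (\<Union>i\<in>I. S i)"
    using insert.IH insert.prems insert.hyps by (auto intro!: add_left_mono)
  also have "\<dots> \<le> hausdorff_measure d (S i \<union> (\<Union>i\<in>I. S i))"
    using insert.hyps insert.prems by (intro hausdorff_measure_Un_separated[OF \<open>0 < \<eta>\<close>]) blast
  finally show ?case
    by simp
qed simp

lemma hausdorff_measure_lipschitz_image:
  fixes f :: "'a::metric_space \<Rightarrow> 'b::metric_space"
  assumes "0 < L" and lip: "\<And>x y. x \<in> S \<Longrightarrow> y \<in> S \<Longrightarrow> dist (f x) (f y) \<le> L * dist x y"
  shows "hausdorff_measure d (f ` S) \<le> ennreal (L ^ d) * hausdorff_measure d S"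
proof (rule hausdorff_measure_least)
  fix \<delta> :: real
  assume "0 < \<delta>"
  have "hausdorff_premeasure d \<delta> (f ` S) / ennreal (L ^ d) \<le> hausdorff_premeasure d (\<delta> / L) S"
  proof (rule hausdorff_premeasure_greatest)
    fix U :: "nat \<Rightarrow> 'a set"
    assume U: "S \<subseteq> (\<Union>i. U i)" "\<And>i. bounded (U i)" "\<And>i. diameter (U i) \<le> \<delta> / L"
    define V where "V i = f ` (U i \<inter> S)" for i
    have dU: "0 \<le> L * diameter (U i)" for i
      using U(2) \<open>0 < L\<close> by (simp add: diameter_ge_0)
    have V: "dist u v \<le> L * diameter (U i)" if uv: "u \<in> V i" "v \<in> V i" for i u v
    proof -
      obtain x y where xy: "x \<in> U i" "x \<in> S" "y \<in> U i" "y \<in> S" "u = f x" "v = f y"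
        using uv unfolding V_def by blast
      then have "dist u v \<le> L * dist x y"
        using lip by simp
      also have "\<dots> \<le> L * diameter (U i)"
        using xy U(2) \<open>0 < L\<close> by (intro mult_left_mono diameter_bounded_bound) auto
      finally show ?thesis .
    qed
    have diam: "diameter (V i) \<le> L * diameter (U i)" for i
      using V[of _ i] dU[of i] by (subst diameter_def) (auto intro!: cSUP_least)
    have bdd: "bounded (V i)" for i
      using V[of _ i] unfolding bounded_two_points by blast
    have "hausdorff_premeasure d \<delta> (f ` S) \<le> (\<Sum>i. ennreal (hausdorff_gauge d (V i)))"
    proof (intro hausdorff_premeasure_le)
      show "f ` S \<subseteq> (\<Union>i. V i)"
        using U(1) by (fastforce simp: V_def)
      show "diameter (V i) \<le> \<delta>" for i
        using diam[of i] U(3)[of i] \<open>0 < L\<close> by (simp add: field_simps)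
    qed (rule bdd)
    also have "\<dots> \<le> (\<Sum>i. ennreal (L ^ d) * ennreal (hausdorff_gauge d (U i)))"
    proof (intro suminf_le)
      fix i
      have "hausdorff_gauge d (V i) \<le> L ^ d * hausdorff_gauge d (U i)"
      proof (cases "V i = {}")
        case True
        then show ?thesis
          using \<open>0 < L\<close> U(2)[of i] by (auto simp: hausdorff_gauge_def diameter_ge_0)
      next
        case False
        then have "U i \<noteq> {}"
          by (auto simp: V_def)
        have "(diameter (V i) / 2) ^ d \<le> (L * (diameter (U i) / 2)) ^ d"
          using diam[of i] bdd[of i] by (intro power_mono) (auto simp: diameter_ge_0)
        then have "unit_ball_vol (real d) * (diameter (V i) / 2) ^ d
            \<le> unit_ball_vol (real d) * (L * (diameter (U i) / 2)) ^ d"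
          by (intro mult_left_mono) auto
        then show ?thesis
          using False \<open>U i \<noteq> {}\<close> unfolding hausdorff_gauge_def power_mult_distrib
          by (simp add: mult_ac)
      qed
      then show "ennreal (hausdorff_gauge d (V i)) \<le> ennreal (L ^ d) * ennreal (hausdorff_gauge d (U i))"
        using \<open>0 < L\<close> by (simp add: ennreal_leI flip: ennreal_mult')
    qed auto
    also have "\<dots> = ennreal (L ^ d) * (\<Sum>i. ennreal (hausdorff_gauge d (U i)))"
      by simp
    finally show "hausdorff_premeasure d \<delta> (f ` S) / ennreal (L ^ d)
        \<le> (\<Sum>i. ennreal (hausdorff_gauge d (U i)))"
      using \<open>0 < L\<close> by (intro divide_le_posI_ennreal) (auto simp: mult.commute)
  qed
  also have "\<dots> \<le> hausdorff_measure d S"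
    using \<open>0 < \<delta>\<close> \<open>0 < L\<close> by (intro hausdorff_premeasure_le_measure) auto
  finally have "hausdorff_premeasure d \<delta> (f ` S) / ennreal (L ^ d) * ennreal (L ^ d)
      \<le> hausdorff_measure d S * ennreal (L ^ d)"
    by (rule mult_right_mono) auto
  moreover have "hausdorff_premeasure d \<delta> (f ` S) / ennreal (L ^ d) * ennreal (L ^ d)
      = hausdorff_premeasure d \<delta> (f ` S)"
    using \<open>0 < L\<close> by (subst ennreal_divide_times) (simp add: ennreal_divide_self)
  ultimately show "hausdorff_premeasure d \<delta> (f ` S) \<le> ennreal (L ^ d) * hausdorff_measure d S"
    by (simp add: mult.commute)
qed

lemma hausdorff_measure_isometric_image:
  fixes f :: "'a::metric_space \<Rightarrow> 'b::metric_space"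
  assumes iso: "\<And>x y. dist (f x) (f y) = dist x y"
  shows "hausdorff_measure d (f ` S) = hausdorff_measure d S"
proof (rule antisym)
  show "hausdorff_measure d (f ` S) \<le> hausdorff_measure d S"
    using hausdorff_measure_lipschitz_image[of 1 S f d] iso by simp
  have "inj f"
    by (rule injI) (metis iso dist_eq_0_iff)
  then have "S = inv f ` f ` S"
    by (simp add: image_image)
  moreover have "dist (inv f x) (inv f y) \<le> 1 * dist x y" if "x \<in> f ` S" "y \<in> f ` S" for x y
    using that iso \<open>inj f\<close> by auto
  then have "hausdorff_measure d (inv f ` f ` S) \<le> hausdorff_measure d (f ` S)"
    using hausdorff_measure_lipschitz_image[of 1 "f ` S" "inv f" d] by simp
  ultimately show "hausdorff_measure d S \<le> hausdorff_measure d (f ` S)"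
    by simp
qed

lemma hausdorff_measure_affine_image:
  fixes S :: "'a::real_normed_vector set"
  assumes "0 < s"
  shows "hausdorff_measure d ((\<lambda>x. q + s *\<^sub>R x) ` S) = ennreal (s ^ d) * hausdorff_measure d S"
proof (rule antisym)
  let ?f = "\<lambda>x. q + s *\<^sub>R x" and ?g = "\<lambda>y. inverse s *\<^sub>R (y - q)"
  show "hausdorff_measure d (?f ` S) \<le> ennreal (s ^ d) * hausdorff_measure d S"
    using assms by (intro hausdorff_measure_lipschitz_image)
      (auto simp: dist_norm simp flip: scaleR_diff_right)
  have "S = ?g ` ?f ` S"
    using assms by (simp add: image_image)
  moreover have "hausdorff_measure d (?g ` ?f ` S) \<le> ennreal (inverse s ^ d) * hausdorff_measure d (?f ` S)"
    using assms by (intro hausdorff_measure_lipschitz_image)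
      (auto simp: dist_norm simp flip: scaleR_diff_right)
  ultimately have "hausdorff_measure d S \<le> ennreal (inverse s ^ d) * hausdorff_measure d (?f ` S)"
    by metis
  then have "ennreal (s ^ d) * hausdorff_measure d S
      \<le> ennreal (s ^ d) * (ennreal (inverse s ^ d) * hausdorff_measure d (?f ` S))"
    by (rule mult_left_mono) auto
  also have "\<dots> = ennreal (s ^ d * inverse s ^ d) * hausdorff_measure d (?f ` S)"
    using assms by (simp add: mult.assoc[symmetric] flip: ennreal_mult)
  also have "s ^ d * inverse s ^ d = 1"
    using assms by (simp flip: power_mult_distrib)
  also have "ennreal 1 * hausdorff_measure d (?f ` S) = hausdorff_measure d (?f ` S)"
    by simp
  finally show "ennreal (s ^ d) * hausdorff_measure d S \<le> hausdorff_measure d (?f ` S)" .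
qed

section \<open>Invariance of volume under orthogonal maps\<close>

text \<open>By the Vitali covering theorem an open box is, up to a null set, a disjoint union of balls, and
  an orthogonal map sends balls to balls of the same radius. So it preserves the volume of boxes,
  which determines the volume of all measurable sets.\<close>

lemma
  fixes f :: "'a::euclidean_space \<Rightarrow> 'a"
  assumes f: "orthogonal_transformation f" and S: "S \<in> lmeasurable"
  shows lmeasurable_orthogonal_image: "f ` S \<in> lmeasurable"
    and measure_lebesgue_orthogonal_image: "measure lebesgue (f ` S) = measure lebesgue S"
proof -
  have lin: "linear f"
    using f by (rule orthogonal_transformation_linear)
  have inj: "inj f"
    using f by (rule orthogonal_transformation_inj)
  have null: "negligible (f ` N)" if "negligible N" for N
    using that lin
    by (intro negligible_differentiable_image_negligible linear_imp_differentiable_on) auto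
  have meas: "f ` S \<in> sets lebesgue" if "open S" for S
    using that f lin inj by (auto intro!: borel_open open_surjective_linear_image orthogonal_transformation_surj)
  have emeasure_open: "emeasure lebesgue (f ` S) = emeasure lebesgue S" if "open S" for S
  proof -
    define K where "K = {(x, r). 0 < r \<and> ball x r \<subseteq> S}"
    have "\<exists>i. i \<in> K \<and> x \<in> ball (fst i) (snd i) \<and> snd i < d" if "x \<in> S" "0 < d" for x d
    proof -
      obtain e where "0 < e" "ball x e \<subseteq> S"
        using \<open>open S\<close> \<open>x \<in> S\<close> open_contains_ball by blast
      then show ?thesis
        using \<open>0 < d\<close> subset_ball[of "min e (d/2)" e x]
        by (intro exI[of _ "(x, min e (d/2))"]) (auto simp: K_def)
    qed
    then obtain C where C: "countable C" "C \<subseteq> K"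
        "pairwise (\<lambda>i j. disjnt (ball (fst i) (snd i)) (ball (fst j) (snd j))) C"
        "negligible (S - (\<Union>i \<in> C. ball (fst i) (snd i)))"
      by (rule Vitali_covering_theorem_balls[where S=S and a=fst and r=snd and K=K]) blast+
    define B where "B i = ball (fst i) (snd i)" for i :: "'a \<times> real"
    have sub: "(\<Union>i\<in>C. B i) \<subseteq> S"
      using C(2) by (fastforce simp: K_def B_def)
    have disj: "disjoint_family_on B C"
      using C(3) unfolding disjoint_family_on_def pairwise_def disjnt_def B_def by blast
    have fB: "f ` B i = ball (f (fst i)) (snd i)" for i
      using f by (simp add: B_def image_orthogonal_transformation_ball)
    have "emeasure lebesgue (f ` S) = emeasure lebesgue (f ` (\<Union>i\<in>C. B i))"
    proof (rule emeasure_eq_AE)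
      have "negligible (f ` (S - (\<Union>i\<in>C. B i)))"
        using C(4) by (intro null) (simp add: B_def)
      then have "AE x in lebesgue. x \<notin> f ` (S - (\<Union>i\<in>C. B i))"
        by (auto simp: negligible_iff_null_sets intro: AE_not_in)
      then show "AE x in lebesgue. x \<in> f ` S \<longleftrightarrow> x \<in> f ` (\<Union>i\<in>C. B i)"
        by eventually_elim (use sub in blast)
    qed (auto intro!: meas \<open>open S\<close> simp: B_def)
    also have "\<dots> = emeasure lebesgue (\<Union>i\<in>C. f ` B i)"
      by (simp add: image_UN)
    also have "\<dots> = (\<integral>\<^sup>+i. emeasure lebesgue (f ` B i) \<partial>count_space C)"
    proof (intro emeasure_UN_countable)
      show "disjoint_family_on (\<lambda>i. f ` B i) C"
        unfolding disjoint_family_on_def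
      proof (intro ballI impI)
        fix i j assume "i \<in> C" "j \<in> C" "i \<noteq> j"
        then have "f ` (B i \<inter> B j) = {}"
          using disj by (simp add: disjoint_family_on_def)
        then show "f ` B i \<inter> f ` B j = {}"
          using inj by (simp add: image_Int)
      qed
    qed (use C(1) in \<open>auto simp: fB\<close>)
    also have "\<dots> = (\<integral>\<^sup>+i. emeasure lebesgue (B i) \<partial>count_space C)"
    proof (intro nn_integral_cong)
      fix i
      assume "i \<in> space (count_space C)"
      then have "0 \<le> snd i"
        using C(2) by (auto simp: K_def)
      then show "emeasure lebesgue (f ` B i) = emeasure lebesgue (B i)"
        unfolding fB unfolding B_def
        using emeasure_lebesgue_ball_conv_unit_ball[of "snd i" "f (fst i)"]
          emeasure_lebesgue_ball_conv_unit_ball[of "snd i" "fst i"] by simp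
    qed
    also have "\<dots> = emeasure lebesgue (\<Union>i\<in>C. B i)"
      using C(1) disj by (intro emeasure_UN_countable[symmetric]) (simp_all add: B_def[abs_def])
    also have "\<dots> = emeasure lebesgue S"
    proof (rule emeasure_eq_AE)
      have "S - (\<Union>i\<in>C. B i) \<in> null_sets lebesgue"
        using C(4) by (simp add: negligible_iff_null_sets B_def)
      then have "AE x in lebesgue. x \<notin> S - (\<Union>i\<in>C. B i)"
        by (rule AE_not_in)
      then show "AE x in lebesgue. x \<in> (\<Union>i\<in>C. B i) \<longleftrightarrow> x \<in> S"
        by eventually_elim (use sub in blast)
    qed (use \<open>open S\<close> in \<open>auto simp: B_def intro!: lborelD borel_open open_UN\<close>)
    finally show ?thesis .
  qed
  have "measure lebesgue (f ` cbox a b) = measure lebesgue (cbox a b)" for a b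
  proof -
    have "negligible (f ` (cbox a b - box a b))"
      by (intro null negligible_frontier_interval)
    then have "AE x in lebesgue. x \<notin> f ` (cbox a b - box a b)"
      by (auto simp: negligible_iff_null_sets intro: AE_not_in)
    then have "AE x in lebesgue. x \<in> f ` cbox a b \<longleftrightarrow> x \<in> f ` box a b"
      by eventually_elim (use box_subset_cbox[of a b] in blast)
    then have "measure lebesgue (f ` cbox a b) = measure lebesgue (f ` box a b)"
      using measurable_linear_image_interval[OF lin, of a b]
      by (intro measure_eq_AE) (auto intro!: meas simp: fmeasurable_def)
    then show ?thesis
      using emeasure_open[OF open_box, of a b]
      by (simp add: measure_def emeasure_lborel_box_eq emeasure_lborel_cbox_eq)
  qed
  then show "f ` S \<in> lmeasurable" "measure lebesgue (f ` S) = measure lebesgue S"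
    using measure_linear_sufficient[OF lin S, of 1] by auto
qed

section \<open>Hausdorff measure of flat sets\<close>

text \<open>
  For an arbitrary index type \<open>'n\<close> no type expression denotes \<open>(n - 1)\<close>-dimensional space, so flat sets
  live in hyperplanes of \<open>real ^ 'n\<close>, and their area is expressed by the volume of the prism of height \<open>s\<close>
  over them, divided by \<open>s\<close>. Here \<open>a\<close> is the unit normal of the hyperplane \<open>a \<bullet> x = b\<close>.
\<close>

definition prism :: "'a::euclidean_space \<Rightarrow> real \<Rightarrow> real \<Rightarrow> 'a set \<Rightarrow> 'a set" where
  "prism a b s A = {x. b \<le> a \<bullet> x \<and> a \<bullet> x \<le> b + s \<and> x - (a \<bullet> x - b) *\<^sub>R a \<in> A}"

definition flat_cube :: "'n \<Rightarrow> real ^ 'n \<Rightarrow> real \<Rightarrow> (real ^ 'n) set" where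
  "flat_cube k p h = {x. x $ k = 0 \<and> (\<forall>i. i \<noteq> k \<longrightarrow> p $ i \<le> x $ i \<and> x $ i \<le> p $ i + h)}"

text \<open>The density of Hausdorff measure with respect to area, on every hyperplane.\<close>

definition cube_area :: "'n::finite \<Rightarrow> ennreal" where
  "cube_area k = hausdorff_measure (CARD('n) - 1) (flat_cube k 0 1)"

lemma prism_borel:
  assumes "A \<in> sets borel"
  shows "prism a b s A \<in> sets borel"
proof -
  have "prism a b s A = {x. b \<le> a \<bullet> x} \<inter> {x. a \<bullet> x \<le> b + s} \<inter> (\<lambda>x. x - (a \<bullet> x - b) *\<^sub>R a) -` A"
    by (auto simp: prism_def)
  moreover have "(\<lambda>x. x - (a \<bullet> x - b) *\<^sub>R a) -` A \<in> sets borel"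
    using measurable_sets[of "\<lambda>x. x - (a \<bullet> x - b) *\<^sub>R a" borel borel A] assms
    by (auto intro!: borel_measurable_continuous_onI continuous_intros)
  moreover have "{x. b \<le> a \<bullet> x} \<in> sets borel" "{x. a \<bullet> x \<le> b + s} \<in> sets borel"
    using closed_halfspace_ge[of b a] closed_halfspace_le[of a "b+s"] by (auto intro: borel_closed)
  ultimately show ?thesis
    by auto
qed

lemma prism_eq_image:
  assumes "norm a = 1" "A \<subseteq> {x. a \<bullet> x = b}"
  shows "prism a b s A = (\<lambda>(x, t). x + t *\<^sub>R a) ` (A \<times> {0..s})"
proof -
  have aa: "a \<bullet> a = 1"
    using assms(1) by (simp add: norm_eq_1)
  show ?thesis
  proof (intro equalityI subsetI)
    fix x assume "x \<in> prism a b s A"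
    then show "x \<in> (\<lambda>(x, t). x + t *\<^sub>R a) ` (A \<times> {0..s})"
      by (intro image_eqI[of _ _ "(x - (a \<bullet> x - b) *\<^sub>R a, a \<bullet> x - b)"]) (auto simp: prism_def)
  next
    fix x assume "x \<in> (\<lambda>(x, t). x + t *\<^sub>R a) ` (A \<times> {0..s})"
    then show "x \<in> prism a b s A"
      using assms(2) aa by (auto simp: prism_def inner_add_right)
  qed
qed

lemma compact_prism:
  assumes "norm a = 1" "A \<subseteq> {x. a \<bullet> x = b}" "compact A"
  shows "compact (prism a b s A)"
  unfolding prism_eq_image[OF assms(1,2)] case_prod_beta
  using assms(3) by (intro compact_continuous_image continuous_intros compact_Times) auto

lemma bounded_prism:
  assumes "norm a = 1" "A \<subseteq> {x. a \<bullet> x = b}" "bounded A"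
  shows "bounded (prism a b s A)"
proof -
  have "bounded ((\<lambda>(x, t). x + t *\<^sub>R a) ` (closure A \<times> {0..s}))"
    unfolding case_prod_beta using assms(3)
    by (intro compact_imp_bounded compact_continuous_image continuous_intros compact_Times) auto
  then show ?thesis
    unfolding prism_eq_image[OF assms(1,2)]
    by (rule bounded_subset) (use closure_subset in fastforce)
qed

lemma emeasure_lborel_box_cart:
  fixes a b :: "real ^ 'n"
  assumes "\<And>i. a $ i \<le> b $ i"
  shows "emeasure lborel (box a b) = ennreal (\<Prod>i\<in>UNIV. b $ i - a $ i)"
    and "emeasure lborel (cbox a b) = ennreal (\<Prod>i\<in>UNIV. b $ i - a $ i)"
proof -
  have "cbox a b \<noteq> {}"
    using assms by (auto simp: interval_ne_empty_cart)
  then have "emeasure lborel (cbox a b) = ennreal (\<Prod>i\<in>UNIV. b $ i - a $ i)"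
    using emeasure_lborel_cbox_finite[of a b] content_cbox_cart[of a b]
    by (simp add: emeasure_eq_ennreal_measure)
  then show "emeasure lborel (cbox a b) = ennreal (\<Prod>i\<in>UNIV. b $ i - a $ i)"
    and "emeasure lborel (box a b) = ennreal (\<Prod>i\<in>UNIV. b $ i - a $ i)"
    by (simp_all add: emeasure_lborel_box_eq emeasure_lborel_cbox_eq)
qed

lemma prod_if_one_coordinate:
  fixes s h :: real
  shows "(\<Prod>i\<in>(UNIV::'n::finite set). if i = k then s else h) = s * h ^ (CARD('n) - 1)"
proof -
  have "(\<Prod>i\<in>(UNIV::'n set). if i = k then s else h) = s * (\<Prod>i\<in>UNIV - {k}. if i = k then s else h)"
    by (subst prod.remove[of _ k]) auto
  also have "(\<Prod>i\<in>UNIV - {k}. if i = k then s else h) = (\<Prod>i\<in>UNIV - {k}. h)"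
    by (intro prod.cong) auto
  finally show ?thesis
    by simp
qed

lemma flat_cube_hyperplane: "flat_cube k p h \<subseteq> {x. axis k 1 \<bullet> x = 0}"
  by (auto simp: flat_cube_def inner_axis')

lemma compact_flat_cube: "compact (flat_cube k p h)"
proof -
  have "flat_cube k p h = cbox (\<chi> i. if i = k then 0 else p $ i) (\<chi> i. if i = k then 0 else p $ i + h)"
    unfolding flat_cube_def set_eq_iff mem_box_cart by (simp split: if_split) (metis order.antisym order.refl)
  then show ?thesis
    by simp
qed

lemma hausdorff_measure_flat_cube:
  fixes p :: "real ^ 'n"
  assumes "0 < h"
  shows "hausdorff_measure (CARD('n) - 1) (flat_cube k p h) = ennreal (h ^ (CARD('n) - 1)) * cube_area k"
proof -
  define q where "q = (\<chi> i. if i = k then 0 else p $ i)"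
  have "flat_cube k p h = (\<lambda>x. q + h *\<^sub>R x) ` flat_cube k 0 1"
  proof (intro equalityI subsetI)
    fix x assume "x \<in> flat_cube k p h"
    then show "x \<in> (\<lambda>x. q + h *\<^sub>R x) ` flat_cube k 0 1"
      using assms by (intro image_eqI[of _ _ "inverse h *\<^sub>R (x - q)"])
        (auto simp: flat_cube_def q_def field_simps)
  qed (use assms in \<open>auto simp: flat_cube_def q_def mult_left_le\<close>)
  then show ?thesis
    unfolding cube_area_def using assms by (simp add: hausdorff_measure_affine_image)
qed

lemma diameter_flat_cube_le:
  fixes p :: "real ^ 'n"
  assumes "0 \<le> h"
  shows "diameter (flat_cube k p h) \<le> real CARD('n) * h"
proof (rule diameter_le)
  fix x y assume xy: "x \<in> flat_cube k p h" "y \<in> flat_cube k p h"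
  have "norm (x - y) \<le> (\<Sum>i\<in>UNIV. \<bar>(x - y) $ i\<bar>)"
    by (rule norm_le_l1_cart)
  also have "\<dots> \<le> (\<Sum>i\<in>(UNIV::'n set). h)"
  proof (rule sum_mono)
    fix i
    show "\<bar>(x - y) $ i\<bar> \<le> h"
      using xy assms by (cases "i = k") (auto simp: flat_cube_def dest!: spec[of _ i])
  qed
  finally show "norm (x - y) \<le> real CARD('n) * h"
    by simp
qed (use assms in simp)

text \<open>Fill the hyperplane with a grid and stack over each grid cube that meets \<open>A\<close> an open box of
  height \<open>s\<close>. The boxes are disjoint, and for a fine grid they stay in any given neighbourhood of
  the prism over \<open>A\<close>: this is how \<open>n\<close>-dimensional volume bounds the number of cubes.\<close>

lemma flat_grid_cover:
  fixes A :: "(real ^ 'n) set"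
  assumes A: "compact A" "A \<subseteq> {x. axis k 1 \<bullet> x = 0}"
    and G: "open G" "prism (axis k 1) 0 s A \<subseteq> G" and "0 < s" "0 < e"
  obtains h Z where "0 < h" "h \<le> e" "finite Z" "A \<subseteq> (\<Union>p\<in>Z. flat_cube k p h)"
    "of_nat (card Z) * ennreal (s * h ^ (CARD('n) - 1)) \<le> emeasure lborel G"
proof -
  define d where "d = CARD('n) - 1"
  have "norm (axis k 1 :: real ^ 'n) = 1"
    by simp
  then have "compact (prism (axis k 1) 0 s A)"
    using A by (intro compact_prism)
  then obtain \<delta> where \<delta>: "0 < \<delta>" "(\<Union>x\<in>prism (axis k 1) 0 s A. ball x \<delta>) \<subseteq> G"
    using G by (rule compact_subset_open_imp_ball_epsilon_subset)
  define h where "h = min e (\<delta> / (2 * real CARD('n)))"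
  have h: "0 < h" "h \<le> e" "real CARD('n) * h < \<delta>"
  proof -
    show "0 < h" "h \<le> e"
      using \<delta> \<open>0 < e\<close> by (auto simp: h_def)
    have "real CARD('n) * h \<le> real CARD('n) * (\<delta> / (2 * real CARD('n)))"
      by (intro mult_left_mono) (auto simp: h_def)
    also have "\<dots> < \<delta>"
      using \<delta> by simp
    finally show "real CARD('n) * h < \<delta>" .
  qed
  define z :: "real ^ 'n \<Rightarrow> real ^ 'n" where "z x = (\<chi> i. h * of_int \<lfloor>x $ i / h\<rfloor>)" for x
  have z: "z x $ i \<le> x $ i" "x $ i < z x $ i + h" for x i
  proof -
    show "z x $ i \<le> x $ i"
      using of_int_floor_le[of "x $ i / h"] h(1) unfolding pos_le_divide_eq[OF h(1)]
      by (simp add: z_def mult.commute)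
    have "x $ i / h < of_int \<lfloor>x $ i / h\<rfloor> + 1"
      by linarith
    then show "x $ i < z x $ i + h"
      using h(1) by (simp add: z_def field_simps)
  qed
  have A0: "x $ k = 0" if "x \<in> A" for x
    using A(2) that by (auto simp: inner_axis')
  have z0: "z x $ k = 0" if "x \<in> A" for x
    using A0[OF that] by (simp add: z_def)
  define Z where "Z = z ` A"
  have "finite Z"
  proof -
    obtain M where M: "\<And>x. x \<in> A \<Longrightarrow> norm x \<le> M"
      using compact_imp_bounded[OF A(1)] by (auto simp: bounded_iff)
    define F where "F = (\<lambda>m. h * of_int m) ` {\<lfloor>- M / h\<rfloor>..\<lfloor>M / h\<rfloor>}"
    have "Z \<subseteq> vec_lambda ` (\<Pi>\<^sub>E i\<in>UNIV. F)"
    proof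
      fix v assume "v \<in> Z"
      then obtain x where x: "x \<in> A" "v = z x"
        by (auto simp: Z_def)
      have "v $ i \<in> F" for i
      proof -
        have "\<bar>x $ i\<bar> \<le> M"
          using M[OF x(1)] component_le_norm_cart[of x i] by simp
        then have "- M / h \<le> x $ i / h" "x $ i / h \<le> M / h"
          using h(1) divide_right_mono[of "- M" "x $ i" h] divide_right_mono[of "x $ i" M h] by auto
        then show ?thesis
          unfolding x(2) z_def F_def by (auto intro!: imageI floor_mono)
      qed
      then show "v \<in> vec_lambda ` (\<Pi>\<^sub>E i\<in>UNIV. F)"
        by (intro image_eqI[of _ _ "vec_nth v"]) (auto simp: vec_nth_inverse)
    qed
    moreover have "finite (\<Pi>\<^sub>E i\<in>(UNIV::'n set). F)"
      by (intro finite_PiE) (auto simp: F_def)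
    ultimately show ?thesis
      by (meson finite_imageI finite_subset)
  qed
  define B where "B p = box p (\<chi> i. if i = k then s else p $ i + h)" for p :: "real ^ 'n"
  have volB: "emeasure lborel (B p) = ennreal (s * h ^ d)" if "p \<in> Z" for p
  proof -
    have "p $ k = 0"
      using that z0 by (auto simp: Z_def)
    then have "emeasure lborel (B p) = ennreal (\<Prod>i\<in>UNIV. (\<chi> i. if i = k then s else p $ i + h) $ i - p $ i)"
      unfolding B_def using h(1) \<open>0 < s\<close> by (intro emeasure_lborel_box_cart) auto
    also have "(\<Prod>i\<in>UNIV. (\<chi> i. if i = k then s else p $ i + h) $ i - p $ i)
        = (\<Prod>i\<in>(UNIV::'n set). if i = k then s else h)"
      using \<open>p $ k = 0\<close> by (intro prod.cong) auto
    finally show ?thesis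
      by (simp add: prod_if_one_coordinate d_def)
  qed
  have disj: "disjoint_family_on B Z"
    unfolding disjoint_family_on_def
  proof (intro ballI impI)
    fix p q assume pq: "p \<in> Z" "q \<in> Z" "p \<noteq> q"
    then obtain i where i: "p $ i \<noteq> q $ i"
      by (auto simp: vec_eq_iff)
    have "i \<noteq> k"
      using i pq z0 by (auto simp: Z_def)
    obtain x y where "p = z x" "q = z y"
      using pq by (auto simp: Z_def)
    then obtain m m' :: int where m: "p $ i = h * of_int m" "q $ i = h * of_int m'"
      using that[of "\<lfloor>x $ i / h\<rfloor>" "\<lfloor>y $ i / h\<rfloor>"] by (simp add: z_def)
    then have "m + 1 \<le> m' \<or> m' + 1 \<le> m"
      using i by (cases m m' rule: linorder_cases) auto
    then have "real_of_int m + 1 \<le> of_int m' \<or> real_of_int m' + 1 \<le> of_int m"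
      by linarith
    then have "h * (real_of_int m + 1) \<le> h * of_int m' \<or> h * (real_of_int m' + 1) \<le> h * of_int m"
      using h(1) by (auto intro: mult_left_mono)
    then have "p $ i + h \<le> q $ i \<or> q $ i + h \<le> p $ i"
      using m by (simp add: distrib_left)
    then show "B p \<inter> B q = {}"
      using \<open>i \<noteq> k\<close> by (auto simp: B_def mem_box_cart dest!: spec[of _ i])
  qed
  have subG: "(\<Union>p\<in>Z. B p) \<subseteq> G"
  proof
    fix y assume "y \<in> (\<Union>p\<in>Z. B p)"
    then obtain x where x: "x \<in> A" "y \<in> B (z x)"
      by (auto simp: Z_def)
    have yk: "0 < y $ k" "y $ k < s"
      using x z0[OF x(1)] by (auto simp: B_def mem_box_cart dest!: spec[of _ k])
    define w where "w = x + (y $ k) *\<^sub>R axis k 1"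
    have "w \<in> prism (axis k 1) 0 s A"
      using x yk A0[OF x(1)] by (auto simp: prism_def w_def inner_axis' )
    moreover have "dist w y < \<delta>"
    proof -
      have "norm (w - y) \<le> (\<Sum>i\<in>UNIV. \<bar>(w - y) $ i\<bar>)"
        by (rule norm_le_l1_cart)
      also have "\<dots> \<le> (\<Sum>i\<in>(UNIV::'n set). h)"
      proof (rule sum_mono)
        fix i
        show "\<bar>(w - y) $ i\<bar> \<le> h"
        proof (cases "i = k")
          case True
          then show ?thesis
            using A0[OF x(1)] h(1) by (simp add: w_def)
        next
          case False
          then have "z x $ i < y $ i" "y $ i < z x $ i + h"
            using x(2) by (auto simp: B_def mem_box_cart dest!: spec[of _ i])
          then show ?thesis
            using z[of x i] False by (simp add: w_def axis_def)
        qed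
      qed
      finally show ?thesis
        using h(3) by (simp add: dist_norm)
    qed
    ultimately show "y \<in> G"
      using \<delta>(2) by (meson UN_I mem_ball subsetD)
  qed
  have "of_nat (card Z) * ennreal (s * h ^ d) = (\<Sum>p\<in>Z. emeasure lborel (B p))"
    using volB by simp
  also have "\<dots> = emeasure lborel (\<Union>p\<in>Z. B p)"
  proof (rule sum_emeasure[OF _ disj \<open>finite Z\<close>])
    show "B ` Z \<subseteq> sets lborel"
      by (auto simp: B_def)
  qed
  also have "\<dots> \<le> emeasure lborel G"
    using subG G(1) by (intro emeasure_mono) auto
  finally have "of_nat (card Z) * ennreal (s * h ^ d) \<le> emeasure lborel G" .
  moreover have "A \<subseteq> (\<Union>p\<in>Z. flat_cube k p h)"
  proof
    fix x assume "x \<in> A"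
    then have "x \<in> flat_cube k (z x) h"
      using z[of x] A0[OF \<open>x \<in> A\<close>] unfolding flat_cube_def mem_Collect_eq by (meson less_imp_le)
    then show "x \<in> (\<Union>p\<in>Z. flat_cube k p h)"
      using \<open>x \<in> A\<close> by (auto simp: Z_def)
  qed
  ultimately show thesis
    using h(1,2) \<open>finite Z\<close> unfolding d_def by (intro that[of h Z])
qed

text \<open>A fine grid covers the unit cube, and the number of its cubes is bounded by a volume.\<close>

lemma cube_area_less_top: "cube_area (k::'n::finite) < top"
proof -
  define d where "d = CARD('n) - 1"
  define Q where "Q = (flat_cube k 0 1 :: (real ^ 'n) set)"
  define P where "P = prism (axis k 1) 0 1 Q"
  have Q: "compact Q" "Q \<subseteq> {x. axis k 1 \<bullet> x = 0}"
    unfolding Q_def by (rule compact_flat_cube flat_cube_hyperplane)+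
  have "bounded P"
    unfolding P_def using Q by (intro bounded_prism) (auto intro: compact_imp_bounded)
  then obtain r where r: "P \<subseteq> ball 0 r"
    using bounded_subset_ballD by blast
  define C where "C = unit_ball_vol (real d) * (real CARD('n) / 2) ^ d"
  have "0 \<le> C"
    by (simp add: C_def)
  have "hausdorff_measure d Q \<le> ennreal C * emeasure lborel (ball 0 r :: (real ^ 'n) set)"
  proof (rule hausdorff_measure_least)
    fix \<delta> :: real
    assume "0 < \<delta>"
    obtain h and Z :: "(real ^ 'n) set" where h: "0 < h" "h \<le> \<delta> / real CARD('n)"
      and Z: "finite Z" "Q \<subseteq> (\<Union>p\<in>Z. flat_cube k p h)"
        "of_nat (card Z) * ennreal (1 * h ^ d) \<le> emeasure lborel (ball 0 r :: (real ^ 'n) set)"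
      using flat_grid_cover[OF Q open_ball r[unfolded P_def], of "\<delta> / real CARD('n)"] \<open>0 < \<delta>\<close>
      unfolding d_def by (metis zero_less_card_finite divide_pos_pos of_nat_0_less_iff zero_less_one)
    have diam: "diameter (flat_cube k p h) \<le> real CARD('n) * h" for p :: "real ^ 'n"
      using h(1) by (intro diameter_flat_cube_le) simp
    have bdd: "bounded (flat_cube k p h)" for p :: "real ^ 'n"
      by (intro compact_imp_bounded compact_flat_cube)
    have "hausdorff_premeasure d \<delta> Q \<le> hausdorff_premeasure d \<delta> (\<Union>p\<in>Z. flat_cube k p h)"
      using Z(2) by (intro hausdorff_premeasure_greatest hausdorff_premeasure_le) auto
    also have "\<dots> \<le> (\<Sum>p\<in>Z. hausdorff_premeasure d \<delta> (flat_cube k p h))"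
      using Z(1) \<open>0 < \<delta>\<close> by (intro hausdorff_premeasure_UN) auto
    also have "\<dots> \<le> (\<Sum>p\<in>Z. ennreal (C * h ^ d))"
    proof (rule sum_mono)
      fix p
      have "real CARD('n) * h \<le> \<delta>"
        using h(2) by (simp add: field_simps)
      then have "hausdorff_premeasure d \<delta> (flat_cube k p h) \<le> ennreal (hausdorff_gauge d (flat_cube k p h))"
        using diam[of p] bdd by (intro hausdorff_premeasure_le_gauge) auto
      also have "hausdorff_gauge d (flat_cube k p h) \<le> C * h ^ d"
      proof -
        have "hausdorff_gauge d (flat_cube k p h) \<le> unit_ball_vol (real d) * (diameter (flat_cube k p h) / 2) ^ d"
          using bdd[of p] by (auto simp: hausdorff_gauge_def diameter_ge_0)
        also have "\<dots> \<le> unit_ball_vol (real d) * (real CARD('n) * h / 2) ^ d"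
          using diam[of p] bdd[of p]
          by (intro mult_left_mono power_mono divide_right_mono) (auto simp: diameter_ge_0)
        also have "\<dots> = C * h ^ d"
          by (simp add: C_def power_mult_distrib power_divide)
        finally show ?thesis .
      qed
      finally show "hausdorff_premeasure d \<delta> (flat_cube k p h) \<le> ennreal (C * h ^ d)"
        by (auto intro: ennreal_leI)
    qed
    also have "\<dots> = ennreal C * (of_nat (card Z) * ennreal (1 * h ^ d))"
      using \<open>0 \<le> C\<close> by (simp add: ennreal_mult' mult_ac)
    also have "\<dots> \<le> ennreal C * emeasure lborel (ball 0 r :: (real ^ 'n) set)"
      using Z(3) by (intro mult_left_mono) auto
    finally show "hausdorff_premeasure d \<delta> Q \<le> ennreal C * emeasure lborel (ball 0 r :: (real ^ 'n) set)" .
  qed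
  also have "\<dots> < top"
    using emeasure_lborel_ball_finite[of "0 :: real ^ 'n" r] by (simp add: ennreal_mult_less_top)
  finally show ?thesis
    by (simp add: cube_area_def Q_def d_def)
qed

text \<open>A set of diameter \<open>\<delta>\<close> lies in a cube of side \<open>2\<delta>\<close> centred at any of its points, so the volume of the
  unit cube bounds the total gauge of a cover from below.\<close>

lemma cube_area_pos: "0 < cube_area (k::'n::finite)"
proof -
  define d where "d = CARD('n) - 1"
  define Q where "Q = (flat_cube k 0 1 :: (real ^ 'n) set)"
  define w where "w = unit_ball_vol (real d)"
  have "0 < w"
    by (simp add: w_def)
  have "ennreal (w / 4 ^ d) \<le> hausdorff_premeasure d 1 Q"
  proof (rule hausdorff_premeasure_greatest)
    fix U :: "nat \<Rightarrow> (real ^ 'n) set"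
    assume U: "Q \<subseteq> (\<Union>i. U i)" "\<And>i. bounded (U i)"
    define D where "D i = (if U i = {} then {} else
      cbox (\<chi> j. if j = k then 0 else (SOME u. u \<in> U i) $ j - diameter (U i))
           (\<chi> j. if j = k then 1 else (SOME u. u \<in> U i) $ j + diameter (U i)))" for i
    have volD: "emeasure lborel (D i) = ennreal (4 ^ d / w) * ennreal (hausdorff_gauge d (U i))" for i
    proof (cases "U i = {}")
      case True
      then show ?thesis
        by (simp add: D_def)
    next
      case False
      have "emeasure lborel (D i) = ennreal (\<Prod>j\<in>(UNIV::'n set). if j = k then 1 else 2 * diameter (U i))"
        unfolding D_def using False diameter_ge_0[OF U(2)[of i]]
        by (simp add: emeasure_lborel_box_cart) (intro arg_cong[where f=ennreal] prod.cong; simp)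
      also have "\<dots> = ennreal (4 ^ d / w * hausdorff_gauge d (U i))"
      proof -
        have "4 ^ d / w * hausdorff_gauge d (U i) = 4 ^ d * (diameter (U i) / 2) ^ d"
          using False \<open>0 < w\<close> by (simp add: hausdorff_gauge_def flip: w_def)
        also have "\<dots> = (2 * diameter (U i)) ^ d"
          unfolding power_mult_distrib[symmetric] by simp
        finally show ?thesis
          by (simp add: prod_if_one_coordinate d_def)
      qed
      finally show ?thesis
        using \<open>0 < w\<close> by (subst ennreal_mult'[symmetric]) auto
    qed
    have "cbox 0 1 \<subseteq> (\<Union>i. D i)"
    proof
      fix y :: "real ^ 'n" assume y: "y \<in> cbox 0 1"
      define x where "x = (\<chi> j. if j = k then 0 else y $ j)"
      have "x \<in> Q"
        using y by (auto simp: Q_def flat_cube_def x_def mem_box_cart)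
      then obtain i where i: "x \<in> U i"
        using U(1) by blast
      have "(SOME u. u \<in> U i) \<in> U i"
        using i by (rule someI)
      have "\<bar>x $ j - (SOME u. u \<in> U i) $ j\<bar> \<le> diameter (U i)" for j
      proof -
        have "\<bar>x $ j - (SOME u. u \<in> U i) $ j\<bar> \<le> dist x (SOME u. u \<in> U i)"
          using component_le_norm_cart[of "x - (SOME u. u \<in> U i)" j] by (simp add: dist_norm)
        also have "\<dots> \<le> diameter (U i)"
          using U(2) i \<open>(SOME u. u \<in> U i) \<in> U i\<close> by (intro diameter_bounded_bound) auto
        finally show ?thesis .
      qed
      then have bound: "x $ j \<le> (SOME u. u \<in> U i) $ j + diameter (U i)"
          "(SOME u. u \<in> U i) $ j - diameter (U i) \<le> x $ j" for j
        by (simp_all add: abs_le_iff algebra_simps)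
      have "y \<in> D i"
      proof -
        have Di: "D i = cbox (\<chi> j. if j = k then 0 else (SOME u. u \<in> U i) $ j - diameter (U i))
             (\<chi> j. if j = k then 1 else (SOME u. u \<in> U i) $ j + diameter (U i))"
          using i by (auto simp: D_def)
        show ?thesis
          unfolding Di mem_box_cart
        proof
          fix j
          show "(\<chi> j. if j = k then 0 else (SOME u. u \<in> U i) $ j - diameter (U i)) $ j \<le> y $ j \<and>
            y $ j \<le> (\<chi> j. if j = k then 1 else (SOME u. u \<in> U i) $ j + diameter (U i)) $ j"
            using y bound[of j] by (cases "j = k") (auto simp: mem_box_cart x_def)
        qed
      qed
      then show "y \<in> (\<Union>i. D i)"
        by blast
    qed
    moreover have "emeasure lborel (cbox 0 1 :: (real ^ 'n) set) = 1"
      by (subst emeasure_lborel_box_cart) auto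
    ultimately have "1 \<le> emeasure lborel (\<Union>i. D i)"
      using emeasure_mono[of "cbox 0 1" "\<Union>i. D i" lborel] by (auto simp: D_def)
    also have "\<dots> \<le> (\<Sum>i. emeasure lborel (D i))"
      by (intro emeasure_subadditive_countably) (auto simp: D_def)
    also have "\<dots> = ennreal (4 ^ d / w) * (\<Sum>i. ennreal (hausdorff_gauge d (U i)))"
      unfolding volD by simp
    finally have "ennreal (w / 4 ^ d) * 1
        \<le> ennreal (w / 4 ^ d) * (ennreal (4 ^ d / w) * (\<Sum>i. ennreal (hausdorff_gauge d (U i))))"
      by (rule mult_left_mono) auto
    also have "\<dots> = (\<Sum>i. ennreal (hausdorff_gauge d (U i)))"
      using \<open>0 < w\<close> by (simp add: mult.assoc[symmetric] flip: ennreal_mult)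
    finally show "ennreal (w / 4 ^ d) \<le> (\<Sum>i. ennreal (hausdorff_gauge d (U i)))"
      by simp
  qed
  moreover have "hausdorff_premeasure d 1 Q \<le> hausdorff_measure d Q"
    by (rule hausdorff_premeasure_le_measure) simp
  moreover have "0 < ennreal (w / 4 ^ d)"
    using \<open>0 < w\<close> by simp
  ultimately show ?thesis
    unfolding cube_area_def Q_def d_def by (meson less_le_trans)
qed

lemma hyperplane_to_coordinate:
  fixes a :: "real ^ 'n" and k :: 'n
  assumes "norm a = 1"
  obtains g :: "real ^ 'n \<Rightarrow> real ^ 'n" where "\<And>x y. dist (g x) (g y) = dist x y" "surj g" "\<And>x. axis k 1 \<bullet> g x = a \<bullet> x - b"
    "\<And>A s. A \<subseteq> {x. a \<bullet> x = b} \<Longrightarrow> prism (axis k 1) 0 s (g ` A) = g ` prism a b s A"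
    "\<And>P. bounded P \<Longrightarrow> P \<in> sets borel \<Longrightarrow> g ` P \<in> sets borel \<Longrightarrow> emeasure lborel (g ` P) = emeasure lborel P"
proof -
  let ?e = "axis k 1 :: real ^ 'n"
  obtain f where f: "orthogonal_transformation f" "f a = ?e"
    using orthogonal_transformation_exists[of a ?e] assms(1) by auto
  let ?g = "\<lambda>x. f x - b *\<^sub>R ?e"
  have lin: "linear f" and inn: "f x \<bullet> f y = x \<bullet> y" for x y
    using f(1) by (auto simp: orthogonal_transformation_def)
  have ge: "?e \<bullet> ?g x = a \<bullet> x - b" for x
    using inn[of a x] by (simp add: f(2) inner_diff_right)
  have pr: "prism ?e 0 s (?g ` A) = ?g ` prism a b s A" if A: "A \<subseteq> {x. a \<bullet> x = b}" for A s
  proof -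
    have gA: "?g ` A \<subseteq> {x. ?e \<bullet> x = 0}"
      using A ge by auto
    have "prism ?e 0 s (?g ` A) = (\<lambda>(x, t). x + t *\<^sub>R ?e) ` (?g ` A \<times> {0..s})"
      using gA by (intro prism_eq_image) auto
    also have "?g ` A \<times> {0..s} = (\<lambda>(x, t). (?g x, t)) ` (A \<times> {0..s})"
      by auto
    also have "(\<lambda>(x, t). x + t *\<^sub>R ?e) ` (\<lambda>(x, t). (?g x, t)) ` (A \<times> {0..s})
        = ?g ` (\<lambda>(x, t). x + t *\<^sub>R a) ` (A \<times> {0..s})"
      unfolding image_image
      by (intro image_cong refl) (auto simp: linear_add[OF lin] linear_scale[OF lin] f(2))
    also have "\<dots> = ?g ` prism a b s A"
      using assms A by (subst prism_eq_image) auto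
    finally show ?thesis .
  qed
  have vol: "emeasure lborel (?g ` P) = emeasure lborel P"
    if P: "bounded P" "P \<in> sets borel" "?g ` P \<in> sets borel" for P
  proof -
    have P': "P \<in> lmeasurable"
      using P by (intro bounded_set_imp_lmeasurable) auto
    then have fP: "f ` P \<in> lmeasurable" "measure lebesgue (f ` P) = measure lebesgue P"
      using lmeasurable_orthogonal_image[OF f(1)] measure_lebesgue_orthogonal_image[OF f(1)] by auto
    have "?g ` P = (\<lambda>x. 1 *\<^sub>R x + (- b *\<^sub>R ?e)) ` f ` P"
      by (auto simp: image_image)
    then have "emeasure lebesgue (?g ` P) = emeasure lebesgue (f ` P)"
      by (simp only: emeasure_lebesgue_affine) simp
    also have "\<dots> = emeasure lebesgue P"
      unfolding emeasure_eq_measure2[OF P'] emeasure_eq_measure2[OF fP(1)] fP(2) ..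
    finally show ?thesis
      using P by simp
  qed
  have surj: "surj ?g"
  proof (rule surjI)
    show "f (inv f (y + b *\<^sub>R ?e)) - b *\<^sub>R ?e = y" for y
      using orthogonal_transformation_surj[OF f(1)] by (simp add: surj_f_inv_f)
  qed
  have iso: "dist (?g x) (?g y) = dist x y" for x y
    using orthogonal_transformation_isometry f(1) by (simp add: dist_norm orthogonal_transformation_norm flip: linear_diff[OF lin])
  show thesis
    by (rule that[of ?g, OF iso surj ge pr vol])
qed

text \<open>The upper bound for compact sets sums over the grid cubes that meet \<open>A\<close>, each of which has Hausdorff
  measure \<open>h ^ (n - 1)\<close> times that of the unit cube; the boxes stacked over them lie in a neighbourhood of
  the prism whose volume is arbitrarily close to that of the prism.\<close>

lemma hausdorff_measure_flat_compact:
  fixes A :: "(real ^ 'n) set" and k :: 'n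
  assumes "norm a = 1" "A \<subseteq> {x. a \<bullet> x = b}" "compact A" "0 < s"
  shows "ennreal s * hausdorff_measure (CARD('n) - 1) A \<le> cube_area k * emeasure lborel (prism a b s A)"
proof -
  define d where "d = CARD('n) - 1"
  have coord: "ennreal s * hausdorff_measure d A \<le> cube_area k * emeasure lborel (prism (axis k 1) 0 s A)"
    if A: "A \<subseteq> {x. axis k 1 \<bullet> x = 0}" "compact A" for A :: "(real ^ 'n) set"
  proof (rule ennreal_le_epsilon)
    fix e :: real
    assume "0 < e"
    have "prism (axis k 1) 0 s A \<in> sets borel"
      using A by (intro prism_borel) (auto intro: borel_compact)
    define e' where "e' = e / (enn2real (cube_area k) + 1)"
    have "0 < e'"
      using \<open>0 < e\<close> by (simp add: e'_def add_nonneg_pos)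
    obtain G where G: "open G" "prism (axis k 1) 0 s A \<subseteq> G"
      "emeasure lborel (G - prism (axis k 1) 0 s A) < e'"
      using outer_regular_lborel[OF \<open>prism (axis k 1) 0 s A \<in> sets borel\<close> \<open>0 < e'\<close>] by blast
    obtain h and Z :: "(real ^ 'n) set" where h: "0 < h"
      and Z: "finite Z" "A \<subseteq> (\<Union>p\<in>Z. flat_cube k p h)"
        "of_nat (card Z) * ennreal (s * h ^ d) \<le> emeasure lborel G"
      using flat_grid_cover[OF A(2,1) G(1,2) \<open>0 < s\<close> zero_less_one] unfolding d_def by metis
    have "hausdorff_measure d A \<le> hausdorff_measure d (\<Union>p\<in>Z. flat_cube k p h)"
      using Z(2) by (rule hausdorff_measure_mono)
    also have "\<dots> \<le> (\<Sum>p\<in>Z. hausdorff_measure d (flat_cube k p h))"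
      using Z(1) by (rule hausdorff_measure_UN)
    also have "\<dots> = of_nat (card Z) * (ennreal (h ^ d) * cube_area k)"
      unfolding d_def hausdorff_measure_flat_cube[OF h] by simp
    finally have "ennreal s * hausdorff_measure d A \<le> ennreal s * (of_nat (card Z) * (ennreal (h ^ d) * cube_area k))"
      by (rule mult_left_mono) simp
    also have "\<dots> = cube_area k * (of_nat (card Z) * ennreal (s * h ^ d))"
      using \<open>0 < s\<close> h by (simp add: ennreal_mult mult_ac)
    also have "\<dots> \<le> cube_area k * emeasure lborel G"
      using Z(3) by (rule mult_left_mono) simp
    also have "\<dots> \<le> cube_area k * (emeasure lborel (prism (axis k 1) 0 s A) + ennreal e')"
    proof (rule mult_left_mono)
      have "emeasure lborel G
          = emeasure lborel (prism (axis k 1) 0 s A) + emeasure lborel (G - prism (axis k 1) 0 s A)"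
        using G(1,2) \<open>prism (axis k 1) 0 s A \<in> sets borel\<close> by (subst plus_emeasure) (auto simp: Un_absorb1)
      then show "emeasure lborel G \<le> emeasure lborel (prism (axis k 1) 0 s A) + ennreal e'"
        using G(3) by (simp add: add_left_mono less_imp_le)
    qed simp
    also have "\<dots> \<le> cube_area k * emeasure lborel (prism (axis k 1) 0 s A) + ennreal e"
    proof -
      have "cube_area k = ennreal (enn2real (cube_area k))"
        using cube_area_less_top[of k] by simp
      then have "cube_area k * ennreal e' = ennreal (enn2real (cube_area k) * e')"
        by (metis ennreal_mult' enn2real_nonneg)
      also have "\<dots> \<le> ennreal e"
      proof (intro ennreal_leI)
        have "0 < enn2real (cube_area k) + 1"
          by (simp add: add_nonneg_pos)
        then show "enn2real (cube_area k) * e' \<le> e"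
          using \<open>0 < e\<close> unfolding e'_def by (simp add: pos_divide_le_eq algebra_simps)
      qed
      finally show ?thesis
        by (simp add: distrib_left add_left_mono)
    qed
    finally show "ennreal s * hausdorff_measure d A
        \<le> cube_area k * emeasure lborel (prism (axis k 1) 0 s A) + ennreal e" .
  qed
  obtain g :: "real ^ 'n \<Rightarrow> real ^ 'n" where g: "\<And>x y. dist (g x) (g y) = dist x y" "surj g" "\<And>x. axis k 1 \<bullet> g x = a \<bullet> x - b"
    "\<And>A s. A \<subseteq> {x. a \<bullet> x = b} \<Longrightarrow> prism (axis k 1) 0 s (g ` A) = g ` prism a b s A"
    "\<And>P. bounded P \<Longrightarrow> P \<in> sets borel \<Longrightarrow> g ` P \<in> sets borel \<Longrightarrow> emeasure lborel (g ` P) = emeasure lborel P"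
    by (rule hyperplane_to_coordinate[OF assms(1), of k b]) (rule that; assumption)
  have "continuous_on A g"
    unfolding continuous_on_iff using g(1) by metis
  then have "compact (g ` A)"
    using assms(3) by (rule compact_continuous_image)
  have gA: "g ` A \<subseteq> {x. axis k 1 \<bullet> x = 0}"
    using assms(2) g(3) by auto
  have "prism (axis k 1) 0 s (g ` A) \<in> sets borel" "prism a b s A \<in> sets borel"
    using \<open>compact (g ` A)\<close> assms(3) by (auto intro: prism_borel borel_compact)
  then have "emeasure lborel (g ` prism a b s A) = emeasure lborel (prism a b s A)"
    using assms g(4) by (intro g(5) bounded_prism) (auto intro: compact_imp_bounded)
  moreover have "hausdorff_measure d (g ` A) = hausdorff_measure d A"
    using g(1) by (rule hausdorff_measure_isometric_image)
  ultimately show ?thesis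
    using coord[OF gA \<open>compact (g ` A)\<close>] g(4)[OF assms(2)] by (simp add: d_def)
qed

text \<open>The reverse inequality for relatively open sets: complete \<open>U\<close> to a large cube, for which equality
  holds by scaling, and apply the compact case to the complement.\<close>

lemma hausdorff_measure_flat_open:
  fixes G :: "(real ^ 'n) set" and k :: 'n
  assumes "norm a = 1" "open G" and U: "U = {x. a \<bullet> x = b} \<inter> G" "bounded U" and "0 < s"
  shows "cube_area k * emeasure lborel (prism a b s U) \<le> ennreal s * hausdorff_measure (CARD('n) - 1) U"
proof -
  define d where "d = CARD('n) - 1"
  obtain g :: "real ^ 'n \<Rightarrow> real ^ 'n" where g: "\<And>x y. dist (g x) (g y) = dist x y" "surj g" "\<And>x. axis k 1 \<bullet> g x = a \<bullet> x - b"
    "\<And>A s. A \<subseteq> {x. a \<bullet> x = b} \<Longrightarrow> prism (axis k 1) 0 s (g ` A) = g ` prism a b s A"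
    "\<And>P. bounded P \<Longrightarrow> P \<in> sets borel \<Longrightarrow> g ` P \<in> sets borel \<Longrightarrow> emeasure lborel (g ` P) = emeasure lborel P"
    by (rule hyperplane_to_coordinate[OF assms(1), of k b]) (rule that; assumption)
  have cont: "continuous_on S g" for S
    unfolding continuous_on_iff using g(1) by metis
  have "\<exists>r>0. \<forall>x\<in>U. norm (g x) \<le> r"
  proof -
    obtain r where r: "\<And>x. x \<in> U \<Longrightarrow> norm x \<le> r"
      using U(2) by (auto simp: bounded_iff)
    have "norm (g x) \<le> \<bar>r\<bar> + norm (g 0) + 1" if "x \<in> U" for x
      using r[OF that] g(1)[of x 0] norm_triangle_ineq[of "g x - g 0" "g 0"] by (simp add: dist_norm)
    then show ?thesis
      by (intro exI[of _ "\<bar>r\<bar> + norm (g 0) + 1"]) (auto simp: add_nonneg_pos)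
  qed
  then obtain r where r: "0 < r" "\<And>x. x \<in> U \<Longrightarrow> norm (g x) \<le> r"
    by blast
  define R where "R = flat_cube k (\<chi> i. - r) (2 * r)"
  define Q where "Q = g -` R"
  have gQ: "g ` Q = R"
    using g(2) by (simp add: Q_def surj_image_vimage_eq)
  have R: "compact R" "R \<subseteq> {x. axis k 1 \<bullet> x = 0}"
    unfolding R_def by (rule compact_flat_cube flat_cube_hyperplane)+
  have Qh: "Q \<subseteq> {x. a \<bullet> x = b}"
    using R(2) g(3) by (auto simp: Q_def)
  have "compact Q"
  proof -
    have "closed Q"
      using R(1) cont unfolding Q_def by (intro closed_vimage compact_imp_closed)
    moreover have "bounded Q"
    proof -
      have "bounded (g ` Q)"
        using R(1) gQ by (simp add: compact_imp_bounded)
      then obtain e where "\<forall>y\<in>g ` Q. dist (g 0) y \<le> e"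
        by (auto simp: bounded_any_center[of _ "g 0"])
      then have "\<forall>x\<in>Q. dist 0 x \<le> e"
        using g(1) by auto
      then show ?thesis
        unfolding bounded_def by blast
    qed
    ultimately show ?thesis
      by (simp add: compact_eq_bounded_closed)
  qed
  have "U \<subseteq> Q"
  proof
    fix x assume "x \<in> U"
    have "g x $ k = 0"
      using g(3)[of x] \<open>x \<in> U\<close> U(1) by (simp add: inner_axis')
    moreover have "- r \<le> g x $ i \<and> g x $ i \<le> r" for i
      using r(2)[OF \<open>x \<in> U\<close>] component_le_norm_cart[of "g x" i] by (simp add: abs_le_iff)
    ultimately show "x \<in> Q"
      by (simp add: Q_def R_def flat_cube_def)
  qed
  have "compact (Q - U)"
  proof -
    have "Q - U = Q \<inter> - G"
      using Qh U(1) by auto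
    then show ?thesis
      using \<open>compact Q\<close> \<open>open G\<close> by (simp add: compact_Int_closed closed_Compl)
  qed
  have borel: "prism a b s U \<in> sets borel" "prism a b s (Q - U) \<in> sets borel" "prism a b s Q \<in> sets borel"
    "prism (axis k 1) 0 s R \<in> sets borel"
  proof -
    have "closed {x. a \<bullet> x = b}"
      by (rule closed_hyperplane)
    then show "prism a b s U \<in> sets borel"
      using \<open>open G\<close> by (intro prism_borel) (auto simp: U(1))
  qed (use \<open>compact Q\<close> \<open>compact (Q - U)\<close> R(1) in \<open>auto intro: prism_borel borel_compact\<close>)
  have volQ: "emeasure lborel (prism a b s Q) = ennreal (s * (2 * r) ^ d)"
  proof -
    have "emeasure lborel (prism a b s Q) = emeasure lborel (g ` prism a b s Q)"
      using assms(1) Qh \<open>compact Q\<close> borel g(4)[OF Qh, symmetric] gQ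
      by (intro g(5)[symmetric] bounded_prism) (auto intro: compact_imp_bounded)
    also have "g ` prism a b s Q = prism (axis k 1) 0 s R"
      using g(4)[OF Qh] gQ by simp
    also have "prism (axis k 1) 0 s R = cbox (\<chi> i. if i = k then 0 else - r) (\<chi> i. if i = k then s else r)"
    proof -
      have nth: "(axis k 1 :: real ^ 'n) $ i = (if i = k then 1 else 0)" for i
        by (simp add: axis_def)
      show ?thesis
        unfolding set_eq_iff prism_def R_def flat_cube_def mem_box_cart
        by (auto simp: inner_axis' nth)
    qed
    also have "emeasure lborel \<dots> = ennreal (\<Prod>i\<in>(UNIV::'n set). if i = k then s else 2 * r)"
      using r(1) \<open>0 < s\<close> by (subst emeasure_lborel_box_cart) (auto intro!: arg_cong[where f=ennreal] prod.cong)
    finally show ?thesis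
      by (simp add: prod_if_one_coordinate d_def)
  qed
  have HQ: "ennreal s * hausdorff_measure d Q = cube_area k * emeasure lborel (prism a b s Q)"
  proof -
    have "hausdorff_measure d Q = hausdorff_measure d R"
      using hausdorff_measure_isometric_image[of g d Q] g(1) gQ by simp
    also have "\<dots> = ennreal ((2 * r) ^ d) * cube_area k"
      unfolding R_def d_def using r(1) by (intro hausdorff_measure_flat_cube) simp
    finally show ?thesis
      unfolding volQ using \<open>0 < s\<close> r(1) by (simp add: ennreal_mult mult_ac)
  qed
  have "cube_area k * emeasure lborel (prism a b s U) + cube_area k * emeasure lborel (prism a b s (Q - U))
      = cube_area k * emeasure lborel (prism a b s Q)"
  proof -
    have "prism a b s U \<inter> prism a b s (Q - U) = {}" "prism a b s U \<union> prism a b s (Q - U) = prism a b s Q"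
      using \<open>U \<subseteq> Q\<close> by (auto simp: prism_def)
    then show ?thesis
      using plus_emeasure[of "prism a b s U" lborel "prism a b s (Q - U)"] borel
      by (simp flip: distrib_left)
  qed
  also have "\<dots> = ennreal s * hausdorff_measure d Q"
    by (rule HQ[symmetric])
  also have "\<dots> \<le> ennreal s * (hausdorff_measure d U + hausdorff_measure d (Q - U))"
    using hausdorff_measure_Un[of d U "Q - U"] \<open>U \<subseteq> Q\<close> by (intro mult_left_mono) (auto simp: Un_absorb1)
  also have "\<dots> \<le> ennreal s * hausdorff_measure d U + cube_area k * emeasure lborel (prism a b s (Q - U))"
    unfolding distrib_left d_def using Qh \<open>compact (Q - U)\<close> \<open>norm a = 1\<close> \<open>0 < s\<close>
    by (intro add_left_mono hausdorff_measure_flat_compact) auto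
  finally have "cube_area k * emeasure lborel (prism a b s U) + cube_area k * emeasure lborel (prism a b s (Q - U))
      \<le> ennreal s * hausdorff_measure d U + cube_area k * emeasure lborel (prism a b s (Q - U))" .
  moreover have "cube_area k * emeasure lborel (prism a b s (Q - U)) < top"
  proof -
    have "emeasure lborel (prism a b s (Q - U)) \<le> emeasure lborel (prism a b s Q)"
      using borel by (intro emeasure_mono) (auto simp: prism_def)
    then show ?thesis
      using cube_area_less_top[of k] volQ by (simp add: ennreal_mult_less_top le_less_trans)
  qed
  ultimately show ?thesis
    by (auto simp: d_def)
qed

section \<open>Surface measure of polytopes\<close>

text \<open>For \<open>P \<subseteq> Q\<close> the nearest-point projection onto \<open>P\<close> is 1-Lipschitz and maps the frontier of
  \<open>Q\<close> onto that of \<open>P\<close>: an outer normal ray at a frontier point of \<open>P\<close> leaves \<open>Q\<close> at a point that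
  projects back to the start.\<close>

lemma hausdorff_measure_frontier_mono:
  fixes P Q :: "'a::euclidean_space set"
  assumes P: "convex P" "closed P" "interior P \<noteq> {}" and Q: "P \<subseteq> Q" "bounded Q"
  shows "hausdorff_measure d (frontier P) \<le> hausdorff_measure d (frontier Q)"
proof -
  have "P \<noteq> {}"
    using P(3) interior_subset by auto
  have "frontier P \<subseteq> closest_point P ` frontier Q"
  proof
    fix x assume x: "x \<in> frontier P"
    then have "x \<in> P"
      using P(2) frontier_subset_closed by blast
    show "x \<in> closest_point P ` frontier Q"
    proof (cases "x \<in> interior Q")
      case False
      then have "x \<in> frontier Q"
        using \<open>x \<in> P\<close> Q(1) closure_subset by (auto simp: frontier_def)
      then show ?thesis
        using \<open>x \<in> P\<close> by (intro image_eqI[of _ _ x]) (auto simp: closest_point_self)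
    next
      case True
      obtain a where a: "a \<noteq> 0" "\<And>y. y \<in> P \<Longrightarrow> a \<bullet> x \<le> a \<bullet> y"
      proof (rule supporting_hyperplane_relative_frontier[OF P(1), of x])
        show "x \<in> closure P" "x \<notin> rel_interior P"
          using x P(3) by (auto simp: frontier_def rel_interior_nonempty_interior)
      qed (use closure_subset in blast)
      obtain \<tau> where \<tau>: "0 < \<tau>" "x + \<tau> *\<^sub>R (- a) \<in> frontier Q"
        using ray_to_frontier[OF Q(2) True, of "- a"] a(1) by auto
      have "x = closest_point P (x + \<tau> *\<^sub>R (- a))"
      proof (rule closest_point_unique[OF P(1,2) \<open>x \<in> P\<close>], rule ballI)
        fix z assume "z \<in> P"
        let ?y = "x + \<tau> *\<^sub>R (- a)"
        have "(norm (?y - x))\<^sup>2 \<le> (norm (?y - z))\<^sup>2"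
        proof -
          have "?y - z = (?y - x) + (x - z)"
            by simp
          then have "(norm (?y - z))\<^sup>2 = (norm (?y - x))\<^sup>2 + 2 * ((?y - x) \<bullet> (x - z)) + (norm (x - z))\<^sup>2"
            by (simp only: power2_norm_eq_inner inner_add_left inner_add_right) (simp add: inner_commute)
          moreover have "0 \<le> (?y - x) \<bullet> (x - z)"
            using a(2)[OF \<open>z \<in> P\<close>] \<tau>(1) by (simp add: inner_diff_right mult_nonneg_nonpos)
          ultimately show ?thesis
            using zero_le_power2[of "norm (x - z)"] by linarith
        qed
        then show "dist ?y x \<le> dist ?y z"
          unfolding dist_norm by (rule power2_le_imp_le) simp
      qed
      then show ?thesis
        using \<tau>(2) by blast
    qed
  qed
  then have "hausdorff_measure d (frontier P) \<le> hausdorff_measure d (closest_point P ` frontier Q)"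
    by (rule hausdorff_measure_mono)
  also have "\<dots> \<le> hausdorff_measure d (frontier Q)"
    using hausdorff_measure_lipschitz_image[of 1 "frontier Q" "closest_point P" d]
      closest_point_lipschitz[OF P(1,2) \<open>P \<noteq> {}\<close>] by simp
  finally show ?thesis .
qed

definition halfspaces :: "('a::euclidean_space \<times> real) set \<Rightarrow> 'a set" where
  "halfspaces E = {x. \<forall>(a, b)\<in>E. a \<bullet> x \<le> b}"

text \<open>For a unit normal this is the signed distance to the bounding hyperplane.\<close>

definition slack :: "'a::euclidean_space \<times> real \<Rightarrow> 'a \<Rightarrow> real" where
  "slack e x = snd e - fst e \<bullet> x"

lemma halfspaces_slack: "halfspaces E = {x. \<forall>e\<in>E. 0 \<le> slack e x}"
  by (auto simp: halfspaces_def slack_def)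

lemma continuous_on_slack [continuous_intros]: "continuous_on S (slack e)"
  unfolding slack_def by (intro continuous_intros)

lemma slack_diff_le:
  assumes "norm (fst e) = 1"
  shows "slack e x - slack e y \<le> dist x y"
proof -
  have "slack e x - slack e y = fst e \<bullet> (y - x)"
    by (simp add: slack_def inner_diff_right)
  also have "\<dots> \<le> norm (fst e) * norm (y - x)"
    by (rule norm_cauchy_schwarz)
  finally show ?thesis
    using assms by (simp add: dist_norm norm_minus_commute)
qed

lemma closed_halfspaces: "closed (halfspaces E)"
proof -
  have "halfspaces E = (\<Inter>e\<in>E. {x. 0 \<le> slack e x})"
    by (auto simp: halfspaces_slack)
  then show ?thesis
    by (auto intro!: closed_INT closed_Collect_le continuous_intros)
qed

lemma convex_halfspaces: "convex (halfspaces E)"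
proof -
  have "halfspaces E = (\<Inter>e\<in>E. {x. fst e \<bullet> x \<le> snd e})"
    by (force simp: halfspaces_def)
  then show ?thesis
    by (auto intro!: convex_INT convex_halfspace_le)
qed

lemma open_slack_greater:
  assumes "finite F"
  shows "open {x. \<forall>e\<in>F. c < slack e x}"
proof -
  have "{x. \<forall>e\<in>F. c < slack e x} = (\<Inter>e\<in>F. {x. c < slack e x})"
    by auto
  then show ?thesis
    using assms by (auto intro!: open_INT open_Collect_less continuous_intros)
qed

lemma frontier_halfspaces:
  assumes "finite E" and unit: "\<And>e. e \<in> E \<Longrightarrow> norm (fst e) = 1"
  shows "frontier (halfspaces E) = {x \<in> halfspaces E. \<exists>e\<in>E. slack e x = 0}"
proof -
  have "interior (halfspaces E) = {x. \<forall>e\<in>E. 0 < slack e x}"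
  proof
    show "{x. \<forall>e\<in>E. 0 < slack e x} \<subseteq> interior (halfspaces E)"
      using assms(1) by (intro interior_maximal open_slack_greater) (auto simp: halfspaces_slack intro: less_imp_le)
    show "interior (halfspaces E) \<subseteq> {x. \<forall>e\<in>E. 0 < slack e x}"
    proof clarify
      fix x a b assume x: "x \<in> interior (halfspaces E)" and e: "(a, b) \<in> E"
      obtain r where r: "0 < r" "cball x r \<subseteq> halfspaces E"
        using x by (auto simp: mem_interior_cball)
      have "x + r *\<^sub>R a \<in> cball x r"
        using r unit[OF e] by (simp add: dist_norm)
      then have "0 \<le> slack (a, b) (x + r *\<^sub>R a)"
        using r e by (auto simp: halfspaces_slack)
      moreover have "a \<bullet> a = 1"
        using unit[OF e] by (simp add: norm_eq_1)
      ultimately show "0 < slack (a, b) x"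
        using r by (simp add: slack_def inner_add_right)
    qed
  qed
  then show ?thesis
    unfolding frontier_def closure_closed[OF closed_halfspaces]
    by (force simp: halfspaces_slack not_less)
qed

text \<open>A point of the polytope that is nearer to one facet than to all others has its foot in the
  relative interior of that facet; all other points lie in finitely many hyperplanes. So, up to a null
  set, the points of depth at most \<open>t\<close> are covered by inward prisms of height \<open>t\<close> over the open facets.\<close>

lemma depth_layer_le_surface:
  fixes E :: "((real ^ 'n) \<times> real) set" and k :: 'n
  assumes "finite E" and unit: "\<And>e. e \<in> E \<Longrightarrow> norm (fst e) = 1"
    and bdd: "bounded (halfspaces E)" and "0 < t"
  shows "cube_area k * emeasure lborel {x \<in> halfspaces E. \<exists>e\<in>E. slack e x \<le> t}
      \<le> ennreal t * hausdorff_measure (CARD('n) - 1) (frontier (halfspaces E))"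
proof -
  define d where "d = CARD('n) - 1"
  define P where "P = halfspaces E"
  define X where "X = {x \<in> P. \<exists>e\<in>E. slack e x \<le> t}"
  define \<eta> where "\<eta> m = 1 / real (Suc m)" for m
  define G where "G e m = {x. \<forall>e'\<in>E - {e}. \<eta> m < slack e' x}" for e m
  define U where "U e m = {x. (- fst e) \<bullet> x = - snd e} \<inter> G e m" for e m
  define V where "V e m = {x \<in> P. slack e x \<le> t \<and> (\<forall>e'\<in>E - {e}. slack e x + \<eta> m < slack e' x)}" for e m
  have \<eta>: "0 < \<eta> m" for m
    by (simp add: \<eta>_def)
  have G: "open (G e m)" for e m
    unfolding G_def using \<open>finite E\<close> by (intro open_slack_greater) auto
  have U0: "slack e x = 0" if "x \<in> U e m" for e x m
    using that by (simp add: U_def slack_def)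
  have U1: "\<eta> m < slack e' x" if "x \<in> U e m" "e' \<in> E" "e' \<noteq> e" for e e' x m
    using that by (simp add: U_def G_def)
  have UP: "U e m \<subseteq> frontier P" if "e \<in> E" for e m
  proof
    fix x assume x: "x \<in> U e m"
    have "0 \<le> slack e' x" if "e' \<in> E" for e'
      using U0[OF x] U1[OF x that] \<eta>[of m] by (cases "e' = e") auto
    then show "x \<in> frontier P"
      using frontier_halfspaces[OF \<open>finite E\<close> unit] U0[OF x] \<open>e \<in> E\<close>
      by (auto simp: P_def halfspaces_slack)
  qed
  have bddU: "bounded (U e m)" if "e \<in> E" for e m
    using UP[OF that] frontier_subset_closed[OF closed_halfspaces[of E]] bounded_subset[OF bdd]
    unfolding P_def by blast
  have borelV: "V e m \<in> sets borel" for e m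
  proof -
    have "V e m = P \<inter> {x. slack e x \<le> t} \<inter> (\<Inter>e'\<in>E - {e}. {x. slack e x + \<eta> m < slack e' x}) "
      by (auto simp: V_def)
    moreover have "open (\<Inter>e'\<in>E - {e}. {x. slack e x + \<eta> m < slack e' x})"
      using \<open>finite E\<close> by (auto intro!: open_INT open_Collect_less continuous_intros)
    moreover have "closed (P \<inter> {x. slack e x \<le> t})"
      unfolding P_def by (intro closed_Int closed_halfspaces closed_Collect_le continuous_intros)
    ultimately show ?thesis
      by (simp add: borel_closed borel_open sets.Int)
  qed
  have borelU: "U e m \<in> sets borel" for e m
    unfolding U_def using G by (intro sets.Int) (auto intro: borel_closed closed_hyperplane)
  have VU: "V e m \<subseteq> prism (- fst e) (- snd e) t (U e m)" if "e \<in> E" for e m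
  proof
    fix x assume x: "x \<in> V e m"
    define y where "y = x + slack e x *\<^sub>R fst e"
    have pos: "0 \<le> slack e x"
      using x \<open>e \<in> E\<close> by (auto simp: V_def P_def halfspaces_slack)
    have ee: "fst e \<bullet> fst e = 1"
      using unit[OF \<open>e \<in> E\<close>] by (simp add: norm_eq_1)
    have "(- fst e) \<bullet> y = - snd e"
      using ee by (simp add: y_def slack_def inner_add_right)
    moreover have "\<eta> m < slack e' y" if "e' \<in> E - {e}" for e'
    proof -
      have "slack e' x - slack e' y \<le> dist x y"
        using that unit by (intro slack_diff_le) auto
      also have "\<dots> = slack e x"
        using pos unit[OF \<open>e \<in> E\<close>] by (simp add: y_def dist_norm)
      finally show ?thesis
        using x that by (force simp: V_def)
    qed
    ultimately have "y \<in> U e m"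
      by (simp add: U_def G_def)
    moreover have "x - ((- fst e) \<bullet> x - (- snd e)) *\<^sub>R (- fst e) = y"
      by (simp add: y_def slack_def algebra_simps)
    ultimately show "x \<in> prism (- fst e) (- snd e) t (U e m)"
      using x pos unfolding prism_def by (auto simp: V_def slack_def)
  qed
  have level: "cube_area k * emeasure lborel (\<Union>e\<in>E. V e m) \<le> ennreal t * hausdorff_measure d (frontier P)" for m
  proof -
    have "cube_area k * emeasure lborel (\<Union>e\<in>E. V e m) \<le> cube_area k * (\<Sum>e\<in>E. emeasure lborel (V e m))"
      using \<open>finite E\<close> borelV by (intro mult_left_mono emeasure_subadditive_finite) auto
    also have "\<dots> = (\<Sum>e\<in>E. cube_area k * emeasure lborel (V e m))"
      by (rule sum_distrib_left)
    also have "\<dots> \<le> (\<Sum>e\<in>E. ennreal t * hausdorff_measure d (U e m))"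
    proof (rule sum_mono)
      fix e assume e: "e \<in> E"
      have "cube_area k * emeasure lborel (V e m)
          \<le> cube_area k * emeasure lborel (prism (- fst e) (- snd e) t (U e m))"
        using VU[OF e] by (intro mult_left_mono emeasure_mono) (simp_all add: prism_borel borelU)
      also have "\<dots> \<le> ennreal t * hausdorff_measure d (U e m)"
        unfolding d_def using unit[OF e] \<open>0 < t\<close> bddU[OF e]
        by (intro hausdorff_measure_flat_open[OF _ G]) (auto simp: U_def)
      finally show "cube_area k * emeasure lborel (V e m) \<le> ennreal t * hausdorff_measure d (U e m)" .
    qed
    also have "\<dots> = ennreal t * (\<Sum>e\<in>E. hausdorff_measure d (U e m))"
      by (rule sum_distrib_left[symmetric])
    also have "\<dots> \<le> ennreal t * hausdorff_measure d (\<Union>e\<in>E. U e m)"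
    proof (intro mult_left_mono hausdorff_measure_UN_separated[OF \<open>finite E\<close> \<eta>])
      fix e e' x y
      assume e: "e \<in> E" "e' \<in> E" "e \<noteq> e'" and xy: "x \<in> U e m" "y \<in> U e' m"
      show "\<eta> m \<le> dist x y"
        using slack_diff_le[OF unit[OF e(2)], of x y] U1[OF xy(1) e(2)] U0[OF xy(2)] e(3) by auto
    qed simp
    also have "\<dots> \<le> ennreal t * hausdorff_measure d (frontier P)"
      using UP by (intro mult_left_mono hausdorff_measure_mono) auto
    finally show ?thesis .
  qed
  define N where "N = (\<Union>(e, e')\<in>{(e, e') \<in> E \<times> E. e \<noteq> e'}. {x. (fst e - fst e') \<bullet> x = snd e - snd e'})"
  have "negligible N"
    unfolding N_def
  proof (rule negligible_Union)
    have "finite (E \<times> E)"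
      using \<open>finite E\<close> by simp
    then show "finite ((\<lambda>(e, e'). {x. (fst e - fst e') \<bullet> x = snd e - snd e'}) ` {(e, e') \<in> E \<times> E. e \<noteq> e'})"
      by (auto intro!: finite_imageI intro: finite_subset[rotated])
  qed (auto intro!: negligible_hyperplane simp: prod_eq_iff)
  then have "N \<in> null_sets lebesgue"
    by (simp add: negligible_iff_null_sets)
  then have AE: "AE x in lebesgue. x \<notin> N"
    by (rule AE_not_in)
  have XV: "x \<in> (\<Union>m. \<Union>e\<in>E. V e m)" if xX: "x \<in> X" "x \<notin> N" for x
  proof -
    have "E \<noteq> {}"
      using xX(1) by (auto simp: X_def)
    then obtain e where e: "e \<in> E" "\<And>e'. e' \<in> E \<Longrightarrow> slack e x \<le> slack e' x"
      using ex_min_if_finite[of "(\<lambda>e. slack e x) ` E"] \<open>finite E\<close>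
      by (auto simp: not_less)
    have gap: "slack e x < slack e' x" if "e' \<in> E - {e}" for e'
    proof -
      have "slack e x \<noteq> slack e' x"
      proof
        assume "slack e x = slack e' x"
        then have "(fst e - fst e') \<bullet> x = snd e - snd e'"
          by (simp add: slack_def inner_diff_left)
        then have "x \<in> N"
          unfolding N_def using that e(1) by (intro UN_I[of "(e, e')"]) auto
        then show False
          using xX(2) by blast
      qed
      then show ?thesis
        using e(2)[of e'] that by auto
    qed
    have "\<exists>m. \<forall>e'\<in>E - {e}. slack e x + \<eta> m < slack e' x"
    proof -
      have "\<forall>\<^sub>F m in sequentially. \<forall>e'\<in>E - {e}. \<eta> m < slack e' x - slack e x"
      proof (intro eventually_ball_finite ballI)
        fix e' assume "e' \<in> E - {e}"
        have "\<eta> \<longlonglongrightarrow> 0"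
          unfolding \<eta>_def using LIMSEQ_inverse_real_of_nat by (simp add: inverse_eq_divide)
        then show "\<forall>\<^sub>F m in sequentially. \<eta> m < slack e' x - slack e x"
          using gap[OF \<open>e' \<in> E - {e}\<close>] by (intro order_tendstoD) auto
      qed (use \<open>finite E\<close> in auto)
      then obtain m where m: "\<forall>e'\<in>E - {e}. \<eta> m < slack e' x - slack e x"
        unfolding eventually_sequentially by (meson order.refl)
      have "slack e x + \<eta> m < slack e' x" if "e' \<in> E - {e}" for e'
        using m[rule_format, OF that] by linarith
      then show ?thesis
        by blast
    qed
    moreover have "slack e x \<le> t"
    proof -
      obtain e' where "e' \<in> E" "slack e' x \<le> t"
        using xX(1) by (auto simp: X_def)
      then show ?thesis
        using e(2)[of e'] by linarith
    qed
    moreover have "x \<in> P"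
      using xX(1) by (simp add: X_def)
    ultimately show ?thesis
      using e(1) by (auto simp: V_def)
  qed
  have incV: "incseq (\<lambda>m. \<Union>e\<in>E. V e m)"
  proof (intro incseq_SucI UN_mono order_refl)
    fix e m
    have "\<eta> (Suc m) \<le> \<eta> m"
      by (simp add: \<eta>_def frac_le)
    then show "V e m \<subseteq> V e (Suc m)"
      by (force simp: V_def)
  qed
  have borelUV: "(\<Union>e\<in>E. V e m) \<in> sets borel" for m
    using \<open>finite E\<close> borelV by (intro sets.finite_UN) auto
  have borelX: "X \<in> sets borel"
  proof -
    have "X = P \<inter> (\<Union>e\<in>E. {x. slack e x \<le> t})"
      by (auto simp: X_def)
    then have "closed X"
      unfolding P_def using \<open>finite E\<close>
      by (auto intro!: closed_Int closed_UN closed_Collect_le closed_halfspaces continuous_intros)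
    then show ?thesis
      by (rule borel_closed)
  qed
  have "emeasure lebesgue X \<le> emeasure lebesgue (\<Union>m. \<Union>e\<in>E. V e m)"
  proof (rule emeasure_mono_AE)
    show "AE x in lebesgue. x \<in> X \<longrightarrow> x \<in> (\<Union>m. \<Union>e\<in>E. V e m)"
      using AE by eventually_elim (use XV in blast)
    show "(\<Union>m. \<Union>e\<in>E. V e m) \<in> sets lebesgue"
      using borelUV by (intro lborelD sets.countable_UN) auto
  qed
  then have "emeasure lborel X \<le> emeasure lborel (\<Union>m. \<Union>e\<in>E. V e m)"
    using borelX borelUV sets.countable_UN[of "\<lambda>m. \<Union>e\<in>E. V e m" UNIV borel] by (auto simp: image_subset_iff)
  also have "\<dots> = (SUP m. emeasure lborel (\<Union>e\<in>E. V e m))"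
    using incV borelUV by (intro SUP_emeasure_incseq[symmetric]) auto
  finally have "cube_area k * emeasure lborel X \<le> (SUP m. cube_area k * emeasure lborel (\<Union>e\<in>E. V e m))"
    unfolding SUP_mult_left_ennreal[symmetric] by (rule mult_left_mono) simp
  also have "\<dots> \<le> ennreal t * hausdorff_measure d (frontier P)"
    using level by (intro SUP_least)
  finally show ?thesis
    by (simp add: X_def P_def d_def)
qed

text \<open>Outward prisms over the facets are disjoint, because a point outside a convex set has only one
  nearest point in it and only one direction towards it.\<close>

lemma surface_le_outer_layer:
  fixes E :: "((real ^ 'n) \<times> real) set" and k :: 'n
  assumes "finite E" and unit: "\<And>e. e \<in> E \<Longrightarrow> norm (fst e) = 1"
    and bdd: "bounded (halfspaces E)" and "0 < s"
    and W: "W \<in> sets borel" "halfspaces E \<subseteq> W"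
      "\<And>a b y \<tau>. (a, b) \<in> E \<Longrightarrow> y \<in> halfspaces E \<Longrightarrow> a \<bullet> y = b \<Longrightarrow> 0 \<le> \<tau> \<Longrightarrow> \<tau> \<le> s \<Longrightarrow> y + \<tau> *\<^sub>R a \<in> W"
  shows "ennreal s * hausdorff_measure (CARD('n) - 1) (frontier (halfspaces E))
        + cube_area k * emeasure lborel (halfspaces E) \<le> cube_area k * emeasure lborel W"
proof -
  define d where "d = CARD('n) - 1"
  define P where "P = halfspaces E"
  have compP: "compact P"
    using bdd closed_halfspaces by (simp add: P_def compact_eq_bounded_closed)
  define F where "F e = P \<inter> {x. fst e \<bullet> x = snd e}" for e
  define S where "S e = prism (fst e) (snd e) s (F e)" for e
  define S' where "S' e = S e - {x. fst e \<bullet> x = snd e}" for e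
  have compF: "compact (F e)" for e
    unfolding F_def using compP by (intro compact_Int_closed closed_hyperplane)
  have borelS: "S e \<in> sets borel" "S' e \<in> sets borel" for e
    unfolding S_def S'_def
    by (intro sets.Diff prism_borel borel_compact compF borel_closed closed_hyperplane)+
  have S'D: "\<exists>y \<tau>. x = y + \<tau> *\<^sub>R fst e \<and> y \<in> P \<and> fst e \<bullet> y = snd e \<and> 0 < \<tau> \<and> \<tau> \<le> s" if "x \<in> S' e" for x e
    using that unfolding S'_def S_def prism_def F_def
    by (intro exI[of _ "x - (fst e \<bullet> x - snd e) *\<^sub>R fst e"] exI[of _ "fst e \<bullet> x - snd e"]) auto
  have disj: "disjoint_family_on S' E"
    unfolding disjoint_family_on_def
  proof (intro ballI impI, rule ccontr)
    fix e e' assume e: "e \<in> E" "e' \<in> E" "e \<noteq> e'" and "S' e \<inter> S' e' \<noteq> {}"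
    then obtain x where x: "x \<in> S' e" "x \<in> S' e'"
      by blast
    obtain y \<tau> where y: "x = y + \<tau> *\<^sub>R fst e" "y \<in> P" "fst e \<bullet> y = snd e" "0 < \<tau>"
      using S'D[OF x(1)] by blast
    obtain y' \<tau>' where y': "x = y' + \<tau>' *\<^sub>R fst e'" "y' \<in> P" "fst e' \<bullet> y' = snd e'" "0 < \<tau>'"
      using S'D[OF x(2)] by blast
    have le: "fst e \<bullet> y' \<le> fst e \<bullet> y" "fst e' \<bullet> y \<le> fst e' \<bullet> y'"
      using y y' e(1,2) by (auto simp: P_def halfspaces_def)
    have "y' - y = \<tau> *\<^sub>R fst e - \<tau>' *\<^sub>R fst e'"
      using y(1) y'(1) by (simp add: algebra_simps)
    then have "(y' - y) \<bullet> (y' - y) = (\<tau> *\<^sub>R fst e - \<tau>' *\<^sub>R fst e') \<bullet> (y' - y)"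
      by simp
    also have "\<dots> = \<tau> * (fst e \<bullet> y' - fst e \<bullet> y) + \<tau>' * (fst e' \<bullet> y - fst e' \<bullet> y')"
      by (simp add: inner_diff_left inner_diff_right algebra_simps)
    also have "\<dots> \<le> 0"
      using le y(4) y'(4) by (intro add_nonpos_nonpos mult_nonneg_nonpos) auto
    finally have "y' = y"
      by (metis order.antisym inner_ge_zero inner_eq_zero_iff right_minus_eq)
    then have eq: "\<tau> *\<^sub>R fst e = \<tau>' *\<^sub>R fst e'"
      using y(1) y'(1) by simp
    then have "norm (\<tau> *\<^sub>R fst e) = norm (\<tau>' *\<^sub>R fst e')"
      by simp
    then have "\<tau> = \<tau>'"
      using y(4) y'(4) unit e by simp
    then have "fst e = fst e'"
      using eq y(4) by simp
    then show False
      using y(3) y'(3) \<open>y' = y\<close> e(3) by (simp add: prod_eq_iff)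
  qed
  have disjP: "(\<Union>e\<in>E. S' e) \<inter> P = {}"
  proof -
    have "x \<notin> P" if xe: "x \<in> S' e" "e \<in> E" for x e
    proof -
      obtain y \<tau> where y: "x = y + \<tau> *\<^sub>R fst e" "fst e \<bullet> y = snd e" "0 < \<tau>"
        using S'D[OF xe(1)] by blast
      have "fst e \<bullet> fst e = 1"
        using unit[OF xe(2)] by (simp add: norm_eq_1)
      then have "snd e < fst e \<bullet> x"
        using y by (simp add: inner_add_right)
      then show ?thesis
        using xe(2) by (force simp: P_def halfspaces_def)
    qed
    then show ?thesis
      by blast
  qed
  have subW: "(\<Union>e\<in>E. S' e) \<union> P \<subseteq> W"
  proof -
    have "x \<in> W" if xe: "x \<in> S' e" "e \<in> E" for x e
    proof -
      obtain y \<tau> where "x = y + \<tau> *\<^sub>R fst e" "y \<in> P" "fst e \<bullet> y = snd e" "0 < \<tau>" "\<tau> \<le> s"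
        using S'D[OF xe(1)] by blast
      then show ?thesis
        using W(3)[of "fst e" "snd e" y \<tau>] xe(2) by (simp add: P_def)
    qed
    then show ?thesis
      using W(2) by (auto simp: P_def)
  qed
  have volS: "emeasure lborel (S e) = emeasure lborel (S' e)" if "e \<in> E" for e
  proof -
    have "fst e \<noteq> 0"
      using unit[OF that] by auto
    then have "{x. fst e \<bullet> x = snd e} \<in> null_sets lebesgue"
      using negligible_hyperplane[of "fst e" "snd e"] by (simp add: negligible_iff_null_sets)
    then have "emeasure lebesgue (S e - {x. fst e \<bullet> x = snd e}) = emeasure lebesgue (S e)"
      using borelS by (intro emeasure_Diff_null_set) auto
    then show ?thesis
      using borelS by (simp flip: S'_def)
  qed
  have "hausdorff_measure d (frontier P) \<le> hausdorff_measure d (\<Union>e\<in>E. F e)"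
    using frontier_halfspaces[OF \<open>finite E\<close> unit]
    by (intro hausdorff_measure_mono) (auto simp: F_def P_def slack_def)
  also have "\<dots> \<le> (\<Sum>e\<in>E. hausdorff_measure d (F e))"
    using \<open>finite E\<close> by (rule hausdorff_measure_UN)
  finally have "ennreal s * hausdorff_measure d (frontier P) \<le> ennreal s * (\<Sum>e\<in>E. hausdorff_measure d (F e))"
    by (rule mult_left_mono) simp
  also have "\<dots> = (\<Sum>e\<in>E. ennreal s * hausdorff_measure d (F e))"
    by (rule sum_distrib_left)
  also have "\<dots> \<le> (\<Sum>e\<in>E. cube_area k * emeasure lborel (S e))"
    unfolding d_def S_def using \<open>0 < s\<close> unit compF
    by (intro sum_mono hausdorff_measure_flat_compact) (auto simp: F_def)
  also have "\<dots> = cube_area k * (\<Sum>e\<in>E. emeasure lborel (S' e))"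
    using volS by (simp add: sum_distrib_left)
  also have "(\<Sum>e\<in>E. emeasure lborel (S' e)) = emeasure lborel (\<Union>e\<in>E. S' e)"
    using disj \<open>finite E\<close> borelS by (intro sum_emeasure) auto
  finally have "ennreal s * hausdorff_measure d (frontier P) + cube_area k * emeasure lborel P
      \<le> cube_area k * (emeasure lborel (\<Union>e\<in>E. S' e) + emeasure lborel P)"
    by (simp add: distrib_left add_right_mono)
  also have "emeasure lborel (\<Union>e\<in>E. S' e) + emeasure lborel P = emeasure lborel ((\<Union>e\<in>E. S' e) \<union> P)"
    using disjP borelS \<open>finite E\<close> compP by (intro plus_emeasure) (auto intro: borel_compact)
  also have "cube_area k * \<dots> \<le> cube_area k * emeasure lborel W"
    using subW W(1) by (intro mult_left_mono emeasure_mono) auto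
  finally show ?thesis
    by (simp add: d_def P_def)
qed

section \<open>Convex domains\<close>

text \<open>Cover \<open>K\<close> by finitely many boxes inside \<open>G\<close>; the convex hull of their vertices is a polytope.\<close>

lemma polytope_between:
  fixes K G :: "'a::euclidean_space set"
  assumes "compact K" "open G" "convex G" "K \<subseteq> G"
  obtains E where "finite E" "\<And>e. e \<in> E \<Longrightarrow> norm (fst e) = 1" "bounded (halfspaces E)"
    "K \<subseteq> halfspaces E" "halfspaces E \<subseteq> G"
proof -
  have "\<exists>B. open B \<and> x \<in> B \<and> (\<exists>V. finite V \<and> V \<subseteq> G \<and> B \<subseteq> convex hull V)" if "x \<in> K" for x
  proof -
    have "x \<in> G"
      using assms(4) that by blast
    then obtain a b where ab: "cbox a b \<subseteq> G" "x \<in> box a b"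
      using \<open>open G\<close> open_contains_cbox by metis
    obtain V where "finite V" "cbox a b = convex hull V"
      using closed_interval_as_convex_hull[of a b] by blast
    moreover have "V \<subseteq> convex hull V"
      by (rule hull_subset)
    ultimately have "finite V \<and> V \<subseteq> G \<and> box a b \<subseteq> convex hull V"
      using ab(1) box_subset_cbox[of a b] by auto
    then show ?thesis
      using ab(2) open_box by metis
  qed
  then obtain B V where BV: "\<And>x. x \<in> K \<Longrightarrow> open (B x) \<and> x \<in> B x \<and> finite (V x) \<and> V x \<subseteq> G \<and> B x \<subseteq> convex hull (V x)"
    by metis
  obtain C where C: "C \<subseteq> K" "finite C" "K \<subseteq> (\<Union>x\<in>C. B x)"
    by (rule compactE_image[OF \<open>compact K\<close>, of K B]) (use BV in auto)
  define P where "P = convex hull (\<Union>x\<in>C. V x)"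
  have "finite (\<Union>x\<in>C. V x)"
    using C BV by auto
  then have P: "polyhedron P" "bounded P"
    unfolding P_def by (auto simp: polyhedron_convex_hull finite_imp_bounded_convex_hull)
  have "K \<subseteq> P"
  proof -
    have "convex hull (V x) \<subseteq> P" if "x \<in> C" for x
      unfolding P_def using that by (intro hull_mono) auto
    then show ?thesis
      using C BV by blast
  qed
  have "P \<subseteq> G"
    unfolding P_def using C BV \<open>convex G\<close> by (intro hull_minimal) auto
  obtain F where F: "finite F" "P = \<Inter> F" "\<forall>h\<in>F. \<exists>a b. a \<noteq> 0 \<and> h = {x. a \<bullet> x \<le> b}"
    using P(1) unfolding polyhedron_def by blast
  then obtain a b where ab: "\<And>h. h \<in> F \<Longrightarrow> a h \<noteq> 0 \<and> h = {x. a h \<bullet> x \<le> b h}"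
    by metis
  define E where "E = (\<lambda>h. (a h /\<^sub>R norm (a h), b h / norm (a h))) ` F"
  have "halfspaces E = P"
  proof -
    have "x \<in> h \<longleftrightarrow> (a h /\<^sub>R norm (a h)) \<bullet> x \<le> b h / norm (a h)" if "h \<in> F" for x h
    proof -
      have "x \<in> h \<longleftrightarrow> a h \<bullet> x \<le> b h"
        using ab[OF that] by blast
      then show ?thesis
        using ab[OF that] by (simp add: field_simps)
    qed
    then show ?thesis
      unfolding F(2) halfspaces_def E_def by auto
  qed
  moreover have "norm (fst e) = 1" if "e \<in> E" for e
    using that ab by (auto simp: E_def)
  moreover have "finite E"
    using F(1) by (simp add: E_def)
  ultimately show thesis
    using P(2) \<open>K \<subseteq> P\<close> \<open>P \<subseteq> G\<close> by (intro that[of E]) auto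
qed

lemma emeasure_lborel_homothety:
  fixes A :: "'a::euclidean_space set"
  assumes "0 < c" "A \<in> sets borel" "(\<lambda>x. c *\<^sub>R x + q) ` A \<in> sets borel"
  shows "emeasure lborel ((\<lambda>x. c *\<^sub>R x + q) ` A) = ennreal (c ^ DIM('a)) * emeasure lborel A"
  using emeasure_lebesgue_affine[of c q A] assms by (simp add: ennreal_power)

lemma surface_measure_closure:
  assumes "convex \<Omega>"
  shows "surface_measure (closure \<Omega>) = surface_measure \<Omega>"
  unfolding surface_measure_def frontier_def
  using convex_interior_closure[OF assms] by simp

lemma emeasure_less_top_bounded:
  assumes "bounded \<Omega>"
  shows "emeasure lborel \<Omega> < top"
  using emeasure_bounded_finite[OF assms] by simp

text \<open>Enclose \<open>\<Omega>\<close> in a polytope \<open>Q\<close> that is contained in the copy of \<open>\<Omega>\<close> scaled by \<open>1 + \<delta>\<close> about \<open>z\<close>.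
  As \<open>Q\<close> contains the ball, scaling \<open>Q\<close> itself by \<open>1 + \<delta>\<close> adds a layer of thickness at least \<open>\<delta> r\<close>,
  whose volume is \<open>n \<delta> |Q|\<close> to first order in \<open>\<delta>\<close>.\<close>

lemma surface_le_volume_if_cball_subset:
  fixes \<Omega> :: "(real ^ 'n) set" and k :: 'n
  assumes \<Omega>: "convex_domain \<Omega>" and "0 < r" "cball z r \<subseteq> \<Omega>"
  obtains \<sigma> where "surface_measure \<Omega> = ennreal \<sigma>" "0 \<le> \<sigma>"
    "r * \<sigma> \<le> real CARD('n) * enn2real (cube_area k) * measure lborel \<Omega>"
proof -
  define n where "n = CARD('n)"
  define C where "C = enn2real (cube_area k)"
  define v where "v = measure lborel \<Omega>"
  have C: "cube_area k = ennreal C" "0 \<le> C"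
    using cube_area_less_top[of k] by (simp_all add: C_def)
  have om: "open \<Omega>" "convex \<Omega>" "bounded \<Omega>" "\<Omega> \<noteq> {}"
    using \<Omega> by (auto simp: convex_domain_def)
  have v: "emeasure lborel \<Omega> = ennreal v"
    unfolding v_def using emeasure_less_top_bounded[OF om(3)] by (simp add: emeasure_eq_ennreal_measure)
  have "z \<in> \<Omega>"
    using assms by auto
  have key: "\<exists>q. 0 \<le> q \<and> q \<le> (1 + \<delta>) ^ n * v \<and>
      ennreal (\<delta> * r) * surface_measure \<Omega> + ennreal (C * q) \<le> ennreal (C * ((1 + \<delta>) ^ n * q))"
    if "0 < \<delta>" for \<delta>
  proof -
    let ?T = "\<lambda>x. (1 + \<delta>) *\<^sub>R x + (- \<delta>) *\<^sub>R z"
    define G where "G = ?T ` \<Omega>"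
    have G_eq: "G = (\<lambda>x. (- \<delta>) *\<^sub>R z + (1 + \<delta>) *\<^sub>R x) ` \<Omega>"
      unfolding G_def by (intro image_cong refl) (rule add.commute)
    have "open G" "convex G"
      unfolding G_eq using om(1,2) that by (intro open_affinity convex_affinity; simp)+
    have "closure \<Omega> \<subseteq> G"
    proof
      fix y assume y: "y \<in> closure \<Omega>"
      define e where "e = \<delta> / (1 + \<delta>)"
      have e: "0 < e" "e \<le> 1" "(1 + \<delta>) * e = \<delta>"
        using that by (auto simp: e_def field_simps)
      have "y - e *\<^sub>R (y - z) \<in> interior \<Omega>"
        using om \<open>z \<in> \<Omega>\<close> y e by (intro mem_interior_closure_convex_shrink) (auto simp: interior_open)
      then have "y - e *\<^sub>R (y - z) \<in> \<Omega>"
        using interior_subset by blast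
      moreover have "?T (y - e *\<^sub>R (y - z)) = y"
      proof -
        have "?T (y - e *\<^sub>R (y - z)) = (1 + \<delta>) *\<^sub>R y - ((1 + \<delta>) * e) *\<^sub>R (y - z) - \<delta> *\<^sub>R z"
          by (simp add: scaleR_diff_right)
        also have "\<dots> = y"
          unfolding e(3) by (simp add: algebra_simps)
        finally show ?thesis .
      qed
      ultimately show "y \<in> G"
        unfolding G_def by (intro image_eqI[of _ _ "y - e *\<^sub>R (y - z)"]) auto
    qed
    moreover have "compact (closure \<Omega>)"
      using om by (simp add: compact_closure)
    ultimately obtain E where E: "finite E" "\<And>e. e \<in> E \<Longrightarrow> norm (fst e) = 1" "bounded (halfspaces E)"
        "closure \<Omega> \<subseteq> halfspaces E" "halfspaces E \<subseteq> G"
      using polytope_between[OF _ \<open>open G\<close> \<open>convex G\<close>] by metis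
    define Q where "Q = halfspaces E"
    define W where "W = ?T ` Q"
    have "compact Q"
      using E(3) closed_halfspaces by (simp add: Q_def compact_eq_bounded_closed)
    then have "compact W"
      unfolding W_def by (intro compact_continuous_image continuous_intros)
    have "convex Q"
      by (simp add: Q_def convex_halfspaces)
    have cb: "cball z r \<subseteq> Q"
      using assms(3) E(4) closure_subset by (auto simp: Q_def)
    have TW: "y + \<delta> *\<^sub>R w \<in> W" if "y \<in> Q" "norm w \<le> r" for y w
    proof -
      define q where "q = (1 / (1 + \<delta>)) *\<^sub>R y + (\<delta> / (1 + \<delta>)) *\<^sub>R (z + w)"
      have "z + w \<in> Q"
        using cb that(2) by (auto simp: dist_norm subset_iff)
      then have "q \<in> Q"
        unfolding q_def using \<open>convex Q\<close> that(1) \<open>0 < \<delta>\<close>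
        by (intro convexD) (auto simp: field_simps)
      moreover have "?T q = y + \<delta> *\<^sub>R w"
        using \<open>0 < \<delta>\<close> by (simp add: q_def scaleR_add_right)
      ultimately show ?thesis
        unfolding W_def by (intro image_eqI[of _ _ q]) auto
    qed
    have le: "ennreal (\<delta> * r) * hausdorff_measure (n - 1) (frontier Q) + cube_area k * emeasure lborel Q
        \<le> cube_area k * emeasure lborel W"
      unfolding n_def Q_def
    proof (rule surface_le_outer_layer[OF E(1-3)])
      show "0 < \<delta> * r"
        using that \<open>0 < r\<close> by simp
      show "W \<in> sets borel"
        using \<open>compact W\<close> by (rule borel_compact)
      show "halfspaces E \<subseteq> W"
        using TW[of _ 0] \<open>0 < r\<close> by (auto simp: Q_def)
      fix a b y \<tau>
      assume *: "(a, b) \<in> E" "y \<in> halfspaces E" "0 \<le> \<tau>" "\<tau> \<le> \<delta> * r"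
      have "norm ((\<tau> / \<delta>) *\<^sub>R a) \<le> r"
        using * E(2)[OF *(1)] that by (simp add: field_simps)
      then show "y + \<tau> *\<^sub>R a \<in> W"
        using TW[of y "(\<tau> / \<delta>) *\<^sub>R a"] *(2) that by (simp add: Q_def)
    qed
    have vQ: "emeasure lborel Q = ennreal (measure lborel Q)"
      using emeasure_less_top_bounded[OF E(3)] by (simp add: emeasure_eq_ennreal_measure Q_def)
    have vW: "emeasure lborel W = ennreal ((1 + \<delta>) ^ n * measure lborel Q)"
      unfolding W_def using that \<open>compact Q\<close> \<open>compact W\<close>
      by (subst emeasure_lborel_homothety) (auto simp: W_def n_def vQ ennreal_mult intro: borel_compact)
    have "emeasure lborel Q \<le> emeasure lborel G"
      using E(5) \<open>open G\<close> by (intro emeasure_mono) (auto simp: Q_def)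
    also have "\<dots> = ennreal ((1 + \<delta>) ^ n * v)"
      unfolding G_def using that om(1) \<open>open G\<close>
      by (subst emeasure_lborel_homothety) (auto simp: G_def n_def v v_def ennreal_mult)
    finally have q: "measure lborel Q \<le> (1 + \<delta>) ^ n * v"
      using that by (simp add: vQ v_def)
    have "surface_measure \<Omega> = surface_measure (closure \<Omega>)"
      using om(2) by (simp add: surface_measure_closure)
    also have "\<dots> \<le> hausdorff_measure (n - 1) (frontier Q)"
      unfolding surface_measure_def n_def using om E(3,4) \<open>z \<in> \<Omega>\<close>
      by (simp add: Q_def) (intro hausdorff_measure_frontier_mono; auto simp: convex_interior_closure interior_open convex_closure)
    finally have "ennreal (\<delta> * r) * surface_measure \<Omega> + ennreal (C * measure lborel Q)
      \<le> ennreal (\<delta> * r) * hausdorff_measure (n - 1) (frontier Q) + cube_area k * emeasure lborel Q"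
      unfolding C(1) vQ using C(2) by (intro add_mono mult_left_mono) (auto simp: ennreal_mult)
    also have "\<dots> \<le> ennreal (C * ((1 + \<delta>) ^ n * measure lborel Q))"
      using le C(2) that unfolding vW C(1) by (simp add: ennreal_mult)
    finally show ?thesis
      using q by (intro exI[of _ "measure lborel Q"]) auto
  qed
  have "surface_measure \<Omega> < top"
  proof -
    obtain q where "ennreal (1 * r) * surface_measure \<Omega> + ennreal (C * q) \<le> ennreal (C * ((1 + 1) ^ n * q))"
      using key[OF zero_less_one] by blast
    then have "ennreal (1 * r) * surface_measure \<Omega> + ennreal (C * q) < top"
      by (rule le_less_trans) simp
    then show ?thesis
      using \<open>0 < r\<close> by (auto simp: ennreal_mult_less_top)
  qed
  then obtain \<sigma> where \<sigma>: "surface_measure \<Omega> = ennreal \<sigma>" "0 \<le> \<sigma>"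
    by (cases "surface_measure \<Omega>") auto
  have bound: "r * \<sigma> \<le> C * (\<Sum>i<n. (1 + \<delta>) ^ i) * ((1 + \<delta>) ^ n * v)" if \<delta>: "0 < \<delta>" for \<delta>
  proof -
    obtain q where q: "0 \<le> q" "q \<le> (1 + \<delta>) ^ n * v"
      "ennreal (\<delta> * r) * surface_measure \<Omega> + ennreal (C * q) \<le> ennreal (C * ((1 + \<delta>) ^ n * q))"
      using key[OF \<delta>] by blast
    have "ennreal (\<delta> * r * \<sigma> + C * q) \<le> ennreal (C * ((1 + \<delta>) ^ n * q))"
      using q \<delta> \<open>0 < r\<close> \<sigma> C(2) by (simp add: ennreal_mult)
    then have "\<delta> * r * \<sigma> + C * q \<le> C * ((1 + \<delta>) ^ n * q)"
      using q(1) C(2) \<delta> by (subst (asm) ennreal_le_iff) auto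
    then have "\<delta> * (r * \<sigma>) \<le> C * (((1 + \<delta>) ^ n - 1) * q)"
      by (simp add: algebra_simps)
    also have "(1 + \<delta>) ^ n - 1 = \<delta> * (\<Sum>i<n. (1 + \<delta>) ^ i)"
      using power_diff_1_eq[of "1 + \<delta>" n] by simp
    also have "C * (\<delta> * (\<Sum>i<n. (1 + \<delta>) ^ i) * q) = \<delta> * (C * (\<Sum>i<n. (1 + \<delta>) ^ i) * q)"
      by simp
    finally have "r * \<sigma> \<le> C * (\<Sum>i<n. (1 + \<delta>) ^ i) * q"
      using \<delta> by simp
    also have "\<dots> \<le> C * (\<Sum>i<n. (1 + \<delta>) ^ i) * ((1 + \<delta>) ^ n * v)"
      using q(2) C(2) \<delta> by (intro mult_left_mono mult_nonneg_nonneg sum_nonneg) auto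
    finally show ?thesis .
  qed
  have "((\<lambda>\<delta>. C * (\<Sum>i<n. (1 + \<delta>) ^ i) * ((1 + \<delta>) ^ n * v)) \<longlongrightarrow> C * (\<Sum>i<n. (1 + 0) ^ i) * ((1 + 0) ^ n * v)) (at_right 0)"
    by (intro tendsto_intros)
  then have "r * \<sigma> \<le> C * (\<Sum>i<n. (1 + 0) ^ i) * ((1 + 0) ^ n * v)"
    by (rule tendsto_lowerbound) (auto simp: eventually_at_right_less intro!: eventually_mono[OF eventually_at_right_less] bound)
  then show thesis
    using \<sigma> by (intro that[of \<sigma>]) (auto simp: n_def C_def v_def mult_ac)
qed

text \<open>Choose a polytope \<open>P\<close> between \<open>\<Omega>\<close> scaled by \<open>\<mu>\<close> and \<open>\<Omega>\<close>, and a largest ball in \<open>P\<close>. Its radius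
  bounds the depth of every point of \<open>P\<close>, so the layer of depth at most \<open>r\<close> is all of \<open>P\<close>.\<close>

lemma exists_cball_volume_le_surface:
  fixes \<Omega> :: "(real ^ 'n) set" and k :: 'n
  assumes \<Omega>: "convex_domain \<Omega>" and \<mu>: "0 < \<mu>" "\<mu> < 1"
  obtains z r where "0 < r" "cball z r \<subseteq> \<Omega>"
    "cube_area k * ennreal (\<mu> ^ CARD('n)) * emeasure lborel \<Omega> \<le> ennreal r * surface_measure \<Omega>"
proof -
  have om: "open \<Omega>" "convex \<Omega>" "bounded \<Omega>" "\<Omega> \<noteq> {}"
    using \<Omega> by (auto simp: convex_domain_def)
  then obtain z\<^sub>0 where z0: "z\<^sub>0 \<in> \<Omega>"
    by blast
  let ?T = "\<lambda>x. \<mu> *\<^sub>R x + (1 - \<mu>) *\<^sub>R z\<^sub>0"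
  have sub: "?T ` closure \<Omega> \<subseteq> \<Omega>"
  proof
    fix y assume "y \<in> ?T ` closure \<Omega>"
    then obtain x where x: "x \<in> closure \<Omega>" "y = ?T x"
      by blast
    have "x - (1 - \<mu>) *\<^sub>R (x - z\<^sub>0) \<in> interior \<Omega>"
      using om z0 x \<mu> by (intro mem_interior_closure_convex_shrink) (auto simp: interior_open)
    moreover have "x - (1 - \<mu>) *\<^sub>R (x - z\<^sub>0) = y"
      by (simp add: x(2) algebra_simps)
    ultimately show "y \<in> \<Omega>"
      using interior_subset by auto
  qed
  have T_open: "open (?T ` \<Omega>)"
  proof -
    have "?T ` \<Omega> = (\<lambda>x. (1 - \<mu>) *\<^sub>R z\<^sub>0 + \<mu> *\<^sub>R x) ` \<Omega>"
      by (intro image_cong refl) (rule add.commute)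
    then show ?thesis
      using open_affinity[OF om(1), of \<mu> "(1 - \<mu>) *\<^sub>R z\<^sub>0"] \<mu> by simp
  qed
  have "compact (?T ` closure \<Omega>)"
    using om by (intro compact_continuous_image continuous_intros) (simp add: compact_closure)
  then obtain E where E: "finite E" "\<And>e. e \<in> E \<Longrightarrow> norm (fst e) = 1" "bounded (halfspaces E)"
      "?T ` closure \<Omega> \<subseteq> halfspaces E" "halfspaces E \<subseteq> \<Omega>"
    using polytope_between[OF _ om(1,2) sub] by metis
  define P where "P = halfspaces E"
  have "compact P"
    using E(3) closed_halfspaces by (simp add: P_def compact_eq_bounded_closed)
  have TP: "?T ` \<Omega> \<subseteq> P"
    using E(4) closure_subset[of \<Omega>] by (auto simp: P_def)
  have "z\<^sub>0 \<in> ?T ` \<Omega>"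
    using z0 by (intro image_eqI[of _ _ z\<^sub>0]) (auto simp: algebra_simps)
  then have z0P: "z\<^sub>0 \<in> interior P"
    using TP T_open interior_maximal by blast
  then have "P \<noteq> {}"
    using interior_subset by auto
  have "P \<noteq> UNIV"
    using E(3) by (auto simp: P_def)
  then have frP: "frontier P \<noteq> {}" "closed (frontier P)"
    using \<open>P \<noteq> {}\<close> by (auto simp: frontier_eq_empty)
  \<comment> \<open>A point farthest from the frontier is the centre of a largest ball in \<open>P\<close>.\<close>
  obtain z where z: "z \<in> P" "\<And>x. x \<in> P \<Longrightarrow> infdist x (frontier P) \<le> infdist z (frontier P)"
    using continuous_attains_sup[OF \<open>compact P\<close> \<open>P \<noteq> {}\<close> continuous_on_infdist[OF continuous_on_id, of P "frontier P"]]
    by auto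
  define r where "r = infdist z (frontier P)"
  have "z\<^sub>0 \<notin> frontier P"
    using z0P by (simp add: frontier_def)
  then have "0 < infdist z\<^sub>0 (frontier P)"
    using frP infdist_pos_not_in_closed by blast
  then have "0 < r"
    using z(2)[of z\<^sub>0] z0P interior_subset unfolding r_def by force
  have "ball z r \<subseteq> P"
  proof (rule ccontr)
    assume "\<not> ball z r \<subseteq> P"
    have "ball z r \<inter> frontier P \<noteq> {}"
    proof (rule connected_Int_frontier)
      show "ball z r \<inter> P \<noteq> {}"
        using z(1) \<open>0 < r\<close> centre_in_ball by blast
      show "ball z r - P \<noteq> {}"
        using \<open>\<not> ball z r \<subseteq> P\<close> by blast
    qed simp
    then obtain w where "dist z w < r" "w \<in> frontier P"
      by auto
    then show False
      using infdist_le[of w "frontier P" z] by (simp add: r_def)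
  qed
  then have "cball z r \<subseteq> P"
    using \<open>0 < r\<close> closure_minimal[of "ball z r" P] \<open>compact P\<close> by (simp add: compact_imp_closed)
  have depth: "\<exists>e\<in>E. slack e x \<le> r" if "x \<in> P" for x
  proof -
    obtain y where y: "y \<in> frontier P" "infdist x (frontier P) = dist x y"
      using infdist_attains_inf[OF frP(2,1)] by blast
    then obtain e where e: "e \<in> E" "slack e y = 0"
      using frontier_halfspaces[OF E(1,2)] by (auto simp: P_def)
    then have "slack e x \<le> dist x y"
      using slack_diff_le[OF E(2), of e x y] by simp
    also have "\<dots> \<le> r"
      using z(2)[OF that] y(2) by (simp add: r_def)
    finally show ?thesis
      using e(1) by blast
  qed
  have "cube_area k * ennreal (\<mu> ^ CARD('n)) * emeasure lborel \<Omega> = cube_area k * emeasure lborel (?T ` \<Omega>)"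
    using om(1) T_open \<mu> by (subst emeasure_lborel_homothety) (auto simp: mult.assoc)
  also have "\<dots> \<le> cube_area k * emeasure lborel P"
    using TP \<open>compact P\<close> by (intro mult_left_mono emeasure_mono) (auto intro: borel_compact)
  also have "P = {x \<in> halfspaces E. \<exists>e\<in>E. slack e x \<le> r}"
    using depth by (auto simp: P_def)
  also have "cube_area k * emeasure lborel \<dots> \<le> ennreal r * hausdorff_measure (CARD('n) - 1) (frontier (halfspaces E))"
    using \<open>0 < r\<close> by (intro depth_layer_le_surface E(1-3))
  also have "\<dots> \<le> ennreal r * surface_measure \<Omega>"
    unfolding surface_measure_def using z0P om(3) E(5)
    by (intro mult_left_mono) (auto simp: P_def intro!: hausdorff_measure_frontier_mono convex_halfspaces closed_halfspaces)
  finally show thesis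
    using \<open>0 < r\<close> \<open>cball z r \<subseteq> P\<close> E(5) by (intro that[of r z]) (auto simp: P_def)
qed

lemma convex_domain_measures:
  fixes \<Omega> :: "(real ^ 'n) set"
  assumes \<Omega>: "convex_domain \<Omega>"
  obtains v \<sigma> where "0 < v" "emeasure lborel \<Omega> = ennreal v" "0 < \<sigma>" "surface_measure \<Omega> = ennreal \<sigma>"
proof -
  obtain k :: 'n where True
    by blast
  have om: "open \<Omega>" "bounded \<Omega>" "\<Omega> \<noteq> {}"
    using \<Omega> by (auto simp: convex_domain_def)
  define v where "v = measure lborel \<Omega>"
  have v: "emeasure lborel \<Omega> = ennreal v"
    unfolding v_def using emeasure_less_top_bounded[OF om(2)] by (simp add: emeasure_eq_ennreal_measure)
  have "emeasure lborel \<Omega> \<noteq> 0"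
    using om(1,3) open_not_negligible[OF om(1,3)] by (auto simp: negligible_iff_emeasure0 negligible_iff_null_sets null_sets_def)
  then have "0 < v"
    using v by (auto simp: ennreal_eq_0_iff not_le)
  obtain z r where zr: "0 < r" "cball z r \<subseteq> \<Omega>"
    "cube_area k * ennreal ((1/2) ^ CARD('n)) * emeasure lborel \<Omega> \<le> ennreal r * surface_measure \<Omega>"
    by (rule exists_cball_volume_le_surface[OF \<Omega>, of "1/2" k]) auto
  obtain \<sigma> where \<sigma>: "surface_measure \<Omega> = ennreal \<sigma>" "0 \<le> \<sigma>"
    using surface_le_volume_if_cball_subset[OF \<Omega> zr(1,2), of k] by blast
  have "\<sigma> \<noteq> 0"
  proof
    assume "\<sigma> = 0"
    then have "cube_area k * ennreal ((1/2) ^ CARD('n)) * ennreal v = 0"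
      using zr(3) by (simp add: \<sigma> v)
    moreover have "0 < ennreal ((1/2) ^ CARD('n))" "0 < ennreal v"
      using \<open>0 < v\<close> by simp_all
    ultimately show False
      using cube_area_pos[of k] by (metis mult_eq_0_iff less_irrefl)
  qed
  then show thesis
    using that[OF \<open>0 < v\<close> v _ \<sigma>(1)] \<sigma>(2) by simp
qed

lemma ratio_le_dimension:
  fixes \<Omega>\<^sub>1 \<Omega>\<^sub>2 :: "(real ^ 'n) set"
  assumes "\<Omega>\<^sub>2 \<subseteq> \<Omega>\<^sub>1" "convex_domain \<Omega>\<^sub>1" "convex_domain \<Omega>\<^sub>2"
  shows "(surface_measure \<Omega>\<^sub>1 / emeasure lborel \<Omega>\<^sub>1) * (emeasure lborel \<Omega>\<^sub>2 / surface_measure \<Omega>\<^sub>2)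
    \<le> of_nat CARD('n)"
proof -
  obtain k :: 'n where True
    by blast
  define n where "n = CARD('n)"
  define C where "C = enn2real (cube_area k)"
  have C: "cube_area k = ennreal C" "0 < C"
    using cube_area_less_top[of k] cube_area_pos[of k] by (auto simp: C_def enn2real_positive_iff)
  obtain v1 s1 where 1: "0 < v1" "emeasure lborel \<Omega>\<^sub>1 = ennreal v1" "0 < s1" "surface_measure \<Omega>\<^sub>1 = ennreal s1"
    using convex_domain_measures[OF assms(2)] by blast
  obtain v2 s2 where 2: "0 < v2" "emeasure lborel \<Omega>\<^sub>2 = ennreal v2" "0 < s2" "surface_measure \<Omega>\<^sub>2 = ennreal s2"
    using convex_domain_measures[OF assms(3)] by blast
  have step: "\<mu> ^ n * (s1 * v2) \<le> real n * (v1 * s2)" if \<mu>: "0 < \<mu>" "\<mu> < 1" for \<mu>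
  proof -
    obtain z r where zr: "0 < r" "cball z r \<subseteq> \<Omega>\<^sub>2"
      "cube_area k * ennreal (\<mu> ^ n) * emeasure lborel \<Omega>\<^sub>2 \<le> ennreal r * surface_measure \<Omega>\<^sub>2"
      unfolding n_def by (rule exists_cball_volume_le_surface[OF assms(3) \<mu>, of k])
    then have "ennreal (C * \<mu> ^ n * v2) \<le> ennreal (r * s2)"
      using C 2 \<mu> by (simp add: ennreal_mult)
    then have a: "C * \<mu> ^ n * v2 \<le> r * s2"
      using 2 zr(1) by (subst (asm) ennreal_le_iff) auto
    obtain \<sigma> where "surface_measure \<Omega>\<^sub>1 = ennreal \<sigma>" "0 \<le> \<sigma>"
      "r * \<sigma> \<le> real CARD('n) * enn2real (cube_area k) * measure lborel \<Omega>\<^sub>1"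
      using surface_le_volume_if_cball_subset[OF assms(2) zr(1) order_trans[OF zr(2) assms(1)], of k] by blast
    then have b: "r * s1 \<le> real n * C * v1"
      using 1 by (simp add: n_def C_def measure_def)
    have "C * (r * (\<mu> ^ n * (s1 * v2))) = (C * \<mu> ^ n * v2) * (r * s1)"
      by (simp add: mult_ac)
    also have "\<dots> \<le> (r * s2) * (real n * C * v1)"
      by (rule mult_mono[OF a b]) (use 1 2 zr(1) in auto)
    also have "\<dots> = C * (r * (real n * (v1 * s2)))"
      by (simp add: mult_ac)
    finally show ?thesis
      using C(2) zr(1) by simp
  qed
  have "((\<lambda>\<mu>. \<mu> ^ n * (s1 * v2)) \<longlongrightarrow> 1 ^ n * (s1 * v2)) (at_left 1)"
    by (intro tendsto_intros)
  moreover have "\<forall>\<^sub>F \<mu> in at_left 1. \<mu> ^ n * (s1 * v2) \<le> real n * (v1 * s2)"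
    using eventually_at_left_real[of 0 "1::real"] by (auto elim!: eventually_mono intro: step)
  ultimately have "1 ^ n * (s1 * v2) \<le> real n * (v1 * s2)"
    by (intro tendsto_upperbound[where F = "at_left (1::real)"]) auto
  then have "(s1 / v1) * (v2 / s2) \<le> real n"
    using 1 2 by (simp add: field_simps)
  then have "ennreal ((s1 / v1) * (v2 / s2)) \<le> ennreal (real n)"
    by (rule ennreal_leI)
  then show ?thesis
    using 1 2 by (simp add: divide_ennreal n_def ennreal_of_nat_eq_real_of_nat flip: ennreal_mult)
qed

section \<open>Sharpness\<close>

lemma halfspaces_domain:
  fixes E :: "((real ^ 'n) \<times> real) set"
  assumes "bounded (halfspaces E)" "interior (halfspaces E) \<noteq> {}"
  shows "convex_domain (interior (halfspaces E))"
    and "emeasure lborel (interior (halfspaces E)) = emeasure lborel (halfspaces E)"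
    and "surface_measure (interior (halfspaces E)) = hausdorff_measure (CARD('n) - 1) (frontier (halfspaces E))"
proof -
  let ?P = "halfspaces E"
  have P: "convex ?P" "closed ?P"
    by (rule convex_halfspaces closed_halfspaces)+
  show "convex_domain (interior ?P)"
    using assms P(1) interior_subset bounded_subset by (auto simp: convex_domain_def convex_interior)
  have fr: "frontier (interior ?P) = frontier ?P"
    using convex_closure_interior[OF P(1) assms(2)] by (simp add: frontier_def)
  then show "surface_measure (interior ?P) = hausdorff_measure (CARD('n) - 1) (frontier ?P)"
    by (simp add: surface_measure_def)
  have "frontier ?P \<in> null_sets lebesgue"
    using negligible_convex_frontier[OF P(1)] by (simp add: negligible_iff_null_sets)
  then have "emeasure lebesgue (?P - frontier ?P) = emeasure lebesgue ?P"
    using P(2) by (intro emeasure_Diff_null_set) auto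
  moreover have "?P - frontier ?P = interior ?P"
    using interior_subset closure_subset by (auto simp: frontier_def)
  ultimately show "emeasure lborel (interior ?P) = emeasure lborel ?P"
    using P(2) by simp
qed

text \<open>If all facets touch the unit ball, the points of depth more than \<open>t\<close> lie in the homothetic
  polytope \<open>(1 - t) P\<close>.\<close>

lemma circumscribed_volume_le_surface:
  fixes E :: "((real ^ 'n) \<times> real) set" and k :: 'n
  assumes E: "finite E" "\<And>e. e \<in> E \<Longrightarrow> norm (fst e) = 1" "bounded (halfspaces E)"
    and touch: "\<And>e. e \<in> E \<Longrightarrow> snd e = 1" and "0 < t" "t < 1"
  shows "cube_area k * emeasure lborel (halfspaces E)
    \<le> ennreal t * hausdorff_measure (CARD('n) - 1) (frontier (halfspaces E))
      + cube_area k * (ennreal ((1 - t) ^ CARD('n)) * emeasure lborel (halfspaces E))"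
proof -
  let ?P = "halfspaces E"
  let ?X = "{x \<in> ?P. \<exists>e\<in>E. slack e x \<le> t}"
  let ?T = "\<lambda>x. (1 - t) *\<^sub>R x + 0"
  have "compact ?P"
    using E(3) closed_halfspaces by (simp add: compact_eq_bounded_closed)
  then have TP: "compact (?T ` ?P)"
    by (intro compact_continuous_image continuous_intros)
  have "?X = ?P \<inter> (\<Union>e\<in>E. {x. slack e x \<le> t})"
    by auto
  then have "closed ?X"
    using E(1) by (auto intro!: closed_Int closed_UN closed_Collect_le closed_halfspaces continuous_intros)
  have "?P \<subseteq> ?X \<union> ?T ` ?P"
  proof
    fix x assume x: "x \<in> ?P"
    show "x \<in> ?X \<union> ?T ` ?P"
    proof (cases "\<exists>e\<in>E. slack e x \<le> t")
      case False
      have "fst e \<bullet> (x /\<^sub>R (1 - t)) \<le> snd e" if "e \<in> E" for e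
        using False that touch[OF that] \<open>t < 1\<close> by (auto simp: slack_def not_le field_simps)
      then have "x /\<^sub>R (1 - t) \<in> ?P"
        by (auto simp: halfspaces_def)
      then show ?thesis
        using \<open>t < 1\<close> by (intro UnI2 image_eqI[of _ _ "x /\<^sub>R (1 - t)"]) auto
    qed (use x in auto)
  qed
  then have "emeasure lborel ?P \<le> emeasure lborel (?X \<union> ?T ` ?P)"
    using \<open>closed ?X\<close> TP by (intro emeasure_mono) (auto intro: borel_closed borel_compact)
  also have "\<dots> \<le> emeasure lborel ?X + emeasure lborel (?T ` ?P)"
    using \<open>closed ?X\<close> TP by (intro emeasure_subadditive) (auto intro: borel_closed borel_compact)
  also have "emeasure lborel (?T ` ?P) = ennreal ((1 - t) ^ CARD('n)) * emeasure lborel ?P"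
    using \<open>t < 1\<close> TP \<open>compact ?P\<close> by (subst emeasure_lborel_homothety) (auto intro: borel_compact)
  finally have "cube_area k * emeasure lborel ?P
      \<le> cube_area k * (emeasure lborel ?X + ennreal ((1 - t) ^ CARD('n)) * emeasure lborel ?P)"
    by (rule mult_left_mono) simp
  also have "\<dots> = cube_area k * emeasure lborel ?X + cube_area k * (ennreal ((1 - t) ^ CARD('n)) * emeasure lborel ?P)"
    by (rule distrib_left)
  also have "cube_area k * emeasure lborel ?X \<le> ennreal t * hausdorff_measure (CARD('n) - 1) (frontier ?P)"
    by (intro depth_layer_le_surface E \<open>0 < t\<close>)
  finally show ?thesis
    by (simp add: add_right_mono)
qed

text \<open>The outer domain is a flat double pyramid, circumscribed about the unit ball, of half-height 1 and
  half-width about \<open>1/\<eta>\<^sup>2\<close>; the inner one is a box of half-height \<open>1 - \<eta>\<close> and half-width \<open>1/\<eta>\<close>. The box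
  is so much narrower than the pyramid that it fits in near the centre, and still so wide that its
  surface is essentially the top and the bottom.\<close>

lemma nearly_extremal_domains:
  fixes k :: "'n::finite"
  assumes \<eta>: "0 < \<eta>" "\<eta> < 1"
  defines "n \<equiv> CARD('n)" and "C \<equiv> enn2real (cube_area k)"
  obtains \<Omega>\<^sub>1 \<Omega>\<^sub>2 :: "(real ^ 'n) set" and v1 s1 v2 s2 where
    "\<Omega>\<^sub>2 \<subseteq> \<Omega>\<^sub>1" "convex_domain \<Omega>\<^sub>1" "convex_domain \<Omega>\<^sub>2"
    "emeasure lborel \<Omega>\<^sub>1 = ennreal v1" "surface_measure \<Omega>\<^sub>1 = ennreal s1"
    "emeasure lborel \<Omega>\<^sub>2 = ennreal v2" "surface_measure \<Omega>\<^sub>2 = ennreal s2"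
    "0 < v1" "0 < s1" "0 < v2" "0 < s2"
    "C * v1 * (1 - (1 - \<eta>) ^ n) \<le> \<eta> * s1"
    "s2 \<le> C * v2 * ((2 - \<eta>) / (1 - \<eta>) * (1 + \<eta>) ^ (n - 1) - 1)"
proof -
  have C: "cube_area k = ennreal C" "0 < C"
    using cube_area_less_top[of k] cube_area_pos[of k] by (auto simp: C_def enn2real_positive_iff)
  \<comment> \<open>The facets have the normals \<open>\<plusminus>e\<^sub>k \<plusminus> \<eta>\<^sup>2 e\<^sub>i\<close>. The index \<open>i = k\<close> yields the constraint \<open>\<bar>x $ k\<bar> \<le> 1\<close>, which
    truncates the tips of the pyramid and is the only one when \<open>n = 1\<close>.\<close>
  define v :: "real \<Rightarrow> real \<Rightarrow> 'n \<Rightarrow> real ^ 'n" where "v \<sigma> \<tau> i = axis k \<sigma> + axis i (\<tau> * \<eta>\<^sup>2)" for \<sigma> \<tau> i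
  define I :: "(real \<times> real \<times> 'n) set" where "I = {1, -1} \<times> {1, -1} \<times> UNIV"
  define E where "E = (\<lambda>(\<sigma>, \<tau>, i). (v \<sigma> \<tau> i /\<^sub>R norm (v \<sigma> \<tau> i), 1::real)) ` I"
  have norm_axis: "norm (axis i c :: real ^ 'n) = \<bar>c\<bar>" for i c
  proof -
    have "axis i c = c *\<^sub>R (axis i 1 :: real ^ 'n)"
      by (simp add: vec_eq_iff axis_def)
    then show ?thesis
      by simp
  qed
  have eta2: "0 < \<eta>\<^sup>2" "\<eta>\<^sup>2 < 1"
    using \<eta> by (auto simp: power_less_one_iff)
  have vk: "v \<sigma> \<tau> i $ k = \<sigma> + (if i = k then \<tau> * \<eta>\<^sup>2 else 0)" for \<sigma> \<tau> i
    by (simp add: v_def axis_def)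
  have vx: "v \<sigma> \<tau> i \<bullet> x = \<sigma> * x $ k + \<tau> * \<eta>\<^sup>2 * x $ i" for \<sigma> \<tau> i x
    by (simp add: v_def inner_add_left inner_axis')
  have vle: "norm (v \<sigma> \<tau> i) \<le> 2" if "(\<sigma>, \<tau>, i) \<in> I" for \<sigma> \<tau> i
  proof -
    have "norm (v \<sigma> \<tau> i) \<le> norm (axis k \<sigma> :: real ^ 'n) + norm (axis i (\<tau> * \<eta>\<^sup>2) :: real ^ 'n)"
      unfolding v_def by (rule norm_triangle_ineq)
    also have "\<dots> = \<bar>\<sigma>\<bar> + \<bar>\<tau>\<bar> * \<eta>\<^sup>2"
      by (simp add: norm_axis abs_mult)
    finally show ?thesis
      using that eta2 by (auto simp: I_def)
  qed
  have vne: "v \<sigma> \<tau> i \<noteq> 0" if "(\<sigma>, \<tau>, i) \<in> I" for \<sigma> \<tau> i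
  proof -
    have "v \<sigma> \<tau> i $ k \<noteq> 0"
    proof
      assume "v \<sigma> \<tau> i $ k = 0"
      then have "\<bar>\<sigma>\<bar> = \<bar>if i = k then \<tau> * \<eta>\<^sup>2 else 0\<bar>"
        unfolding vk by linarith
      moreover have "\<bar>\<sigma>\<bar> = 1" "\<bar>\<tau> * \<eta>\<^sup>2\<bar> < 1"
        using that eta2 by (auto simp: I_def abs_mult)
      ultimately show False
        by (auto split: if_splits)
    qed
    then show ?thesis
      by auto
  qed
  have PE: "halfspaces E = {x. \<forall>(\<sigma>, \<tau>, i)\<in>I. v \<sigma> \<tau> i \<bullet> x \<le> norm (v \<sigma> \<tau> i)}"
  proof -
    have "(v \<sigma> \<tau> i /\<^sub>R norm (v \<sigma> \<tau> i)) \<bullet> x \<le> 1 \<longleftrightarrow> v \<sigma> \<tau> i \<bullet> x \<le> norm (v \<sigma> \<tau> i)"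
      if "(\<sigma>, \<tau>, i) \<in> I" for \<sigma> \<tau> i x
      using vne[OF that] by (simp add: field_simps)
    then show ?thesis
      unfolding halfspaces_def E_def by fastforce
  qed
  have E: "finite E" "\<And>e. e \<in> E \<Longrightarrow> norm (fst e) = 1" "\<And>e. e \<in> E \<Longrightarrow> snd e = 1"
    using vne by (auto simp: E_def I_def)
  have bddE: "bounded (halfspaces E)"
  proof -
    have "halfspaces E \<subseteq> cbox (\<chi> i. - 2 / \<eta>\<^sup>2) (\<chi> i. 2 / \<eta>\<^sup>2)"
    proof
      fix x assume "x \<in> halfspaces E"
      then have le: "\<sigma> * x $ k + \<tau> * \<eta>\<^sup>2 * x $ i \<le> 2" if "(\<sigma>, \<tau>, i) \<in> I" for \<sigma> \<tau> i
        using that vle[OF that] vx[of \<sigma> \<tau> i x] unfolding PE by fastforce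
      have "- 2 / \<eta>\<^sup>2 \<le> x $ i \<and> x $ i \<le> 2 / \<eta>\<^sup>2" for i
        using le[of 1 1 i] le[of "-1" 1 i] le[of 1 "-1" i] le[of "-1" "-1" i] eta2(1)
        by (simp add: I_def field_simps)
      then show "x \<in> cbox (\<chi> i. - 2 / \<eta>\<^sup>2) (\<chi> i. 2 / \<eta>\<^sup>2)"
        by (simp add: mem_box_cart)
    qed
    then show ?thesis
      using bounded_cbox bounded_subset by blast
  qed
  define w :: "real ^ 'n" where "w = (\<chi> i. if i = k then 1 - \<eta> else 1 / \<eta>)"
  have w0: "0 < w $ i" for i
    using \<eta> by (simp add: w_def)
  define F :: "((real ^ 'n) \<times> real) set" where "F = (\<lambda>(\<sigma>, i). (axis i \<sigma>, w $ i)) ` ({1, -1} \<times> UNIV)"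
  have F: "finite F" "\<And>e. e \<in> F \<Longrightarrow> norm (fst e) = 1"
    by (auto simp: F_def norm_axis)
  have PF: "halfspaces F = cbox (- w) w"
    unfolding set_eq_iff mem_box_cart halfspaces_def F_def
    by (auto simp: inner_axis') (metis minus_le_iff)+
  have bddF: "bounded (halfspaces F)"
    by (simp add: PF)
  have intF: "interior (halfspaces F) = box (- w) w" "box (- w) w \<noteq> {}"
    using w0 by (auto simp: PF interval_ne_empty_cart)
  have sub: "box (- w) w \<subseteq> halfspaces E"
  proof
    fix x assume "x \<in> box (- w) w"
    then have x: "\<bar>x $ i\<bar> \<le> w $ i" for i
      by (auto simp: mem_box_cart abs_le_iff dest!: spec[of _ i])
    have "v \<sigma> \<tau> i \<bullet> x \<le> norm (v \<sigma> \<tau> i)" if "(\<sigma>, \<tau>, i) \<in> I" for \<sigma> \<tau> i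
    proof -
      have "v \<sigma> \<tau> i \<bullet> x \<le> \<bar>v \<sigma> \<tau> i $ k\<bar>"
      proof (cases "i = k")
        case True
        have "v \<sigma> \<tau> i \<bullet> x = v \<sigma> \<tau> i $ k * x $ k"
          unfolding vx vk using True by (simp add: algebra_simps)
        also have "\<dots> \<le> \<bar>v \<sigma> \<tau> i $ k\<bar> * \<bar>x $ k\<bar>"
          by (metis abs_ge_self abs_mult)
        also have "\<dots> \<le> \<bar>v \<sigma> \<tau> i $ k\<bar> * 1"
          using x[of k] \<eta> by (intro mult_left_mono) (auto simp: w_def)
        finally show ?thesis
          by simp
      next
        case False
        have "\<eta>\<^sup>2 * \<bar>x $ i\<bar> \<le> \<eta>\<^sup>2 * (1 / \<eta>)"
          using x[of i] False by (intro mult_left_mono) (auto simp: w_def)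
        also have "\<dots> = \<eta>"
          using \<eta> by (simp add: power2_eq_square)
        finally have "\<eta>\<^sup>2 * \<bar>x $ i\<bar> \<le> \<eta>" .
        moreover have "\<tau> * \<eta>\<^sup>2 * x $ i \<le> \<eta>\<^sup>2 * \<bar>x $ i\<bar>"
        proof -
          have "\<tau> * \<eta>\<^sup>2 * x $ i = \<eta>\<^sup>2 * (\<tau> * x $ i)"
            by simp
          also have "\<dots> \<le> \<eta>\<^sup>2 * \<bar>x $ i\<bar>"
            using that by (intro mult_left_mono) (auto simp: I_def)
          finally show ?thesis .
        qed
        moreover have "\<sigma> * x $ k \<le> 1 - \<eta>"
          using that x[of k] by (auto simp: I_def w_def)
        moreover have "\<bar>v \<sigma> \<tau> i $ k\<bar> = 1"
          using False that by (auto simp: vk I_def)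
        ultimately show ?thesis
          unfolding vx by linarith
      qed
      also have "\<dots> \<le> norm (v \<sigma> \<tau> i)"
        by (rule component_le_norm_cart)
      finally show ?thesis .
    qed
    then show "x \<in> halfspaces E"
      unfolding PE by blast
  qed
  define \<Omega>\<^sub>1 where "\<Omega>\<^sub>1 = interior (halfspaces E)"
  define \<Omega>\<^sub>2 where "\<Omega>\<^sub>2 = interior (halfspaces F)"
  have "\<Omega>\<^sub>2 \<subseteq> \<Omega>\<^sub>1"
    unfolding \<Omega>\<^sub>1_def \<Omega>\<^sub>2_def intF(1) using sub by (intro interior_maximal open_box)
  have ne: "interior (halfspaces F) \<noteq> {}" "interior (halfspaces E) \<noteq> {}"
    using intF \<open>\<Omega>\<^sub>2 \<subseteq> \<Omega>\<^sub>1\<close> by (auto simp: \<Omega>\<^sub>1_def \<Omega>\<^sub>2_def)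
  note D1 = halfspaces_domain[OF bddE ne(2), folded \<Omega>\<^sub>1_def n_def]
  note D2 = halfspaces_domain[OF bddF ne(1), folded \<Omega>\<^sub>2_def n_def]
  obtain v1 s1 where 1: "0 < v1" "emeasure lborel \<Omega>\<^sub>1 = ennreal v1" "0 < s1" "surface_measure \<Omega>\<^sub>1 = ennreal s1"
    using convex_domain_measures[OF D1(1)] by blast
  obtain v2 s2 where 2: "0 < v2" "emeasure lborel \<Omega>\<^sub>2 = ennreal v2" "0 < s2" "surface_measure \<Omega>\<^sub>2 = ennreal s2"
    using convex_domain_measures[OF D2(1)] by blast
  have "cube_area k * emeasure lborel \<Omega>\<^sub>1 \<le> ennreal \<eta> * surface_measure \<Omega>\<^sub>1
      + cube_area k * (ennreal ((1 - \<eta>) ^ n) * emeasure lborel \<Omega>\<^sub>1)"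
    unfolding D1 n_def by (intro circumscribed_volume_le_surface E bddE \<eta>)
  then have "ennreal (C * v1) \<le> ennreal (\<eta> * s1 + C * ((1 - \<eta>) ^ n * v1))"
    unfolding 1 C(1) using 1 C(2) \<eta> by (simp add: ennreal_mult)
  then have "C * v1 \<le> \<eta> * s1 + C * ((1 - \<eta>) ^ n * v1)"
    using 1 C(2) \<eta> by (subst (asm) ennreal_le_iff) auto
  then have r1: "C * v1 * (1 - (1 - \<eta>) ^ n) \<le> \<eta> * s1"
    by (simp add: algebra_simps)
  \<comment> \<open>Already a layer of thickness 1 determines the surface up to a factor that tends to 1 with \<open>\<eta> \<rightarrow> 0\<close>.\<close>
  define W where "W = cbox (- (\<chi> i. w $ i + 1)) (\<chi> i. w $ i + 1)"
  have "ennreal 1 * surface_measure \<Omega>\<^sub>2 + cube_area k * emeasure lborel \<Omega>\<^sub>2 \<le> cube_area k * emeasure lborel W"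
    unfolding D2 n_def
  proof (rule surface_le_outer_layer[OF F bddF])
    show "halfspaces F \<subseteq> W"
    proof
      fix x assume "x \<in> halfspaces F"
      then have "- (w $ i) \<le> x $ i \<and> x $ i \<le> w $ i" for i
        by (simp add: PF mem_box_cart)
      then have "- (w $ i + 1) \<le> x $ i \<and> x $ i \<le> w $ i + 1" for i
        by (smt (verit))
      then show "x \<in> W"
        by (simp add: W_def mem_box_cart)
    qed
    fix a b y \<tau>
    assume *: "(a, b) \<in> F" "y \<in> halfspaces F" "0 \<le> \<tau>" "\<tau> \<le> (1::real)"
    have "\<bar>(\<tau> *\<^sub>R a) $ i\<bar> \<le> 1" for i
    proof -
      have "\<bar>(\<tau> *\<^sub>R a) $ i\<bar> \<le> norm (\<tau> *\<^sub>R a)"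
        by (rule component_le_norm_cart)
      then show ?thesis
        using F(2)[OF *(1)] * by simp
    qed
    moreover have "- (w $ i) \<le> y $ i \<and> y $ i \<le> w $ i" for i
      using *(2) by (auto simp: PF mem_box_cart)
    ultimately show "y + \<tau> *\<^sub>R a \<in> W"
      unfolding W_def mem_box_cart abs_le_iff
      by (simp add: add_mono) (smt (verit))
  qed (auto simp: W_def)
  moreover have vW: "emeasure lborel W = ennreal (2 * (2 - \<eta>) * (2 * (1 / \<eta> + 1)) ^ (n - 1))"
  proof -
    have "emeasure lborel W = ennreal (\<Prod>i\<in>UNIV. (\<chi> i. w $ i + 1) $ i - (- (\<chi> i. w $ i + 1)) $ i)"
      unfolding W_def using w0 by (intro emeasure_lborel_box_cart) (simp add: less_imp_le add_nonneg_nonneg)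
    also have "(\<Prod>i\<in>UNIV. (\<chi> i. w $ i + 1) $ i - (- (\<chi> i. w $ i + 1)) $ i)
        = (\<Prod>i\<in>(UNIV::'n set). if i = k then 2 * (2 - \<eta>) else 2 * (1 / \<eta> + 1))"
      by (intro prod.cong) (auto simp: w_def)
    finally show ?thesis
      by (simp add: prod_if_one_coordinate n_def)
  qed
  ultimately have "ennreal (s2 + C * v2) \<le> ennreal (C * (2 * (2 - \<eta>) * (2 * (1 / \<eta> + 1)) ^ (n - 1)))"
    unfolding 2 C(1) using 2 C(2) \<eta> by (simp add: ennreal_mult)
  then have "s2 + C * v2 \<le> C * (2 * (2 - \<eta>) * (2 * (1 / \<eta> + 1)) ^ (n - 1))"
    using \<eta> C(2) by (subst (asm) ennreal_le_iff) (auto intro!: mult_nonneg_nonneg zero_le_power)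
  also have "2 * (2 - \<eta>) * (2 * (1 / \<eta> + 1)) ^ (n - 1) = v2 * ((2 - \<eta>) / (1 - \<eta>) * (1 + \<eta>) ^ (n - 1))"
  proof -
    have "emeasure lborel \<Omega>\<^sub>2 = ennreal (\<Prod>i\<in>UNIV. w $ i - (- w) $ i)"
      unfolding \<Omega>\<^sub>2_def intF(1) using w0 by (intro emeasure_lborel_box_cart) (simp add: less_imp_le)
    also have "(\<Prod>i\<in>UNIV. w $ i - (- w) $ i) = (\<Prod>i\<in>(UNIV::'n set). if i = k then 2 * (1 - \<eta>) else 2 / \<eta>)"
      by (intro prod.cong) (auto simp: w_def)
    finally have "ennreal v2 = ennreal (2 * (1 - \<eta>) * (2 / \<eta>) ^ (n - 1))"
      by (simp add: prod_if_one_coordinate n_def 2)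
    then have v2: "v2 = 2 * (1 - \<eta>) * (2 / \<eta>) ^ (n - 1)"
      using 2 \<eta> by (subst (asm) ennreal_inj) auto
    have cancel: "2 * (2 - \<eta>) * (p * q) = 2 * (1 - \<eta>) * p * ((2 - \<eta>) / (1 - \<eta>) * q)" for p q :: real
      using \<eta> by (simp add: field_simps)
    have "2 * (1 / \<eta> + 1) = 2 / \<eta> * (1 + \<eta>)"
      using \<eta> by (simp add: field_simps)
    then show ?thesis
      unfolding v2 by (simp only: power_mult_distrib cancel)
  qed
  finally have r2: "s2 \<le> C * v2 * ((2 - \<eta>) / (1 - \<eta>) * (1 + \<eta>) ^ (n - 1) - 1)"
    by (simp add: algebra_simps)
  show thesis
    by (rule that[OF \<open>\<Omega>\<^sub>2 \<subseteq> \<Omega>\<^sub>1\<close> D1(1) D2(1) 1(2,4) 2(2,4) 1(1,3) 2(1,3) r1 r2])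
qed

theorem mainTheorem3:
  shows "Sup {(surface_measure \<Omega>\<^sub>1 / emeasure lborel \<Omega>\<^sub>1) * (emeasure lborel \<Omega>\<^sub>2 / surface_measure \<Omega>\<^sub>2)
            | \<Omega>\<^sub>1 \<Omega>\<^sub>2 :: (real ^ 'n) set.
              \<Omega>\<^sub>2 \<subseteq> \<Omega>\<^sub>1 \<and> convex_domain \<Omega>\<^sub>1 \<and> convex_domain \<Omega>\<^sub>2}
         = of_nat CARD('n)"
    (is "Sup ?R = _")
proof (rule antisym)
  show "Sup ?R \<le> of_nat CARD('n)"
    using ratio_le_dimension by (intro Sup_least) blast
  obtain k :: 'n where True
    by blast
  define n where "n = CARD('n)"
  define C where "C = enn2real (cube_area k)"
  have "0 < C"
    using cube_area_less_top[of k] cube_area_pos[of k] by (auto simp: C_def enn2real_positive_iff)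
  define h where "h \<eta> = (\<Sum>i<n. (1 - \<eta>) ^ i) / ((2 - \<eta>) / (1 - \<eta>) * (1 + \<eta>) ^ (n - 1) - 1)" for \<eta> :: real
  have "ennreal (h \<eta>) \<le> Sup ?R" if \<eta>: "0 < \<eta>" "\<eta> < 1" for \<eta>
  proof -
    obtain \<Omega>\<^sub>1 \<Omega>\<^sub>2 :: "(real ^ 'n) set" and v1 s1 v2 s2 where
      D: "\<Omega>\<^sub>2 \<subseteq> \<Omega>\<^sub>1" "convex_domain \<Omega>\<^sub>1" "convex_domain \<Omega>\<^sub>2"
      and m: "emeasure lborel \<Omega>\<^sub>1 = ennreal v1" "surface_measure \<Omega>\<^sub>1 = ennreal s1"
        "emeasure lborel \<Omega>\<^sub>2 = ennreal v2" "surface_measure \<Omega>\<^sub>2 = ennreal s2"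
      and pos: "0 < v1" "0 < s1" "0 < v2" "0 < s2"
      and r: "C * v1 * (1 - (1 - \<eta>) ^ n) \<le> \<eta> * s1"
        "s2 \<le> C * v2 * ((2 - \<eta>) / (1 - \<eta>) * (1 + \<eta>) ^ (n - 1) - 1)"
      unfolding C_def n_def by (rule nearly_extremal_domains[OF \<eta>, of k])
    define g where "g = (2 - \<eta>) / (1 - \<eta>) * (1 + \<eta>) ^ (n - 1) - 1"
    define S where "S = (\<Sum>i<n. (1 - \<eta>) ^ i)"
    have "1 - (1 - \<eta>) ^ n = \<eta> * S"
      using one_diff_power_eq[of "1 - \<eta>" n] by (simp add: S_def)
    then have "\<eta> * (C * v1 * S) \<le> \<eta> * s1"
      using r(1) by (simp add: mult_ac)
    then have a: "C * v1 * S \<le> s1"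
      using \<eta> by simp
    have b: "s2 \<le> C * v2 * g"
      using r(2) by (simp add: g_def)
    have "0 < C * v2 * g"
      using b pos by linarith
    then have "0 < g"
      using pos \<open>0 < C\<close> zero_less_mult_pos[of "C * v2" g] by simp
    have "0 \<le> S"
      unfolding S_def using \<eta> by (intro sum_nonneg) auto
    have "(C * v1 * S) * s2 \<le> s1 * (C * v2 * g)"
      by (rule mult_mono[OF a b]) (use pos in auto)
    then have "C * (S * (v1 * s2)) \<le> C * (g * (s1 * v2))"
      by (simp add: mult_ac)
    then have "S * (v1 * s2) \<le> g * (s1 * v2)"
      using \<open>0 < C\<close> by simp
    then have "S / g \<le> (s1 / v1) * (v2 / s2)"
      using pos \<open>0 < g\<close> by (simp add: field_simps)
    then have "ennreal (h \<eta>) \<le> ennreal ((s1 / v1) * (v2 / s2))"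
      by (intro ennreal_leI) (simp add: h_def S_def g_def)
    also have "\<dots> = (surface_measure \<Omega>\<^sub>1 / emeasure lborel \<Omega>\<^sub>1) * (emeasure lborel \<Omega>\<^sub>2 / surface_measure \<Omega>\<^sub>2)"
      unfolding m using pos by (simp add: divide_ennreal flip: ennreal_mult)
    also have "\<dots> \<le> Sup ?R"
      using D by (intro Sup_upper) blast
    finally show ?thesis .
  qed
  then have "\<forall>\<^sub>F \<eta> in at_right 0. ennreal (h \<eta>) \<le> Sup ?R"
    using eventually_at_right_real[of 0 "1::real"] by (auto elim!: eventually_mono)
  moreover have "((\<lambda>\<eta>. ennreal (h \<eta>)) \<longlongrightarrow> ennreal ((\<Sum>i<n. (1 - 0) ^ i) / ((2 - 0) / (1 - 0) * (1 + 0) ^ (n - 1) - 1))) (at_right 0)"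
    unfolding h_def by (intro tendsto_ennrealI tendsto_intros) auto
  ultimately have "ennreal ((\<Sum>i<n. (1 - 0) ^ i) / ((2 - 0) / (1 - 0) * (1 + 0) ^ (n - 1) - 1)) \<le> Sup ?R"
    by (intro tendsto_upperbound[where F = "at_right (0::real)"]) auto
  then show "of_nat CARD('n) \<le> Sup ?R"
    by (simp add: n_def ennreal_of_nat_eq_real_of_nat)
qed

end
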